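(* Let $G$ be a group with finite symmetric generating set $Y$, and let $\mathbb Z=\langle a\rangle$ have generating set $X=\{a,a^{-1}\}$. Then the conjugacy growth series of $(G\wr\mathbb Z,\vec Y)$ is $$\tilde\sigma_{(G\wr\mathbb Z,\vec Y)}(z)=2\sum_{r\ge1}\frac{\phi(r)}{r}\sum_{s\ge1}\frac{z^{rs}\,\sigma_{(G,Y)}(z^r)^s}{s}+\tilde\sigma_{(G,Y)}(z)+\frac{z^2\bigl(\tilde\sigma_{(G,Y)}(z)-1\bigr)^2}{1-z^2\tilde\sigma_{(G,Y)}(z)},$$ where $\phi$ is Euler's totient function. Moreover, the radius of convergence of $\tilde\sigma_{(G\wr\mathbb Z,\vec Y)}(z)$ is the unique positive value $t$ such that $t\,\sigma_{(G,Y)}(t)=1$.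
   Context: Wreath product. Let $L=\mathbb Z$, and let $e,e'$ be the neutral elements of $G,L$. $G\wr L=\bigl(\bigoplus_{i\in L}G\bigr)\rtimes L$ with product $(\eta,m)(\theta,n)=(\eta\theta^m,mn)$, where $\theta^m(i)=\theta(m^{-1}i)$. For $g\in G$, $\vec g\in\bigoplus_{i\in L}G$ has value $g$ at $e'$ and $e$ elsewhere. The generating set is $\vec Y=\{(\vec e,x):x\in X\}\cup\{(\vec y,e'):y\in Y\}$. Growth series. For a group $H$ with finite symmetric generating set $Z$, $|h|_Z$ is the word length. The standard growth series is $\sigma_{(H,Z)}(z)=\sum_{n\ge0}\#\{h\in H:|h|_Z=n\}z^n$. The length of a conjugacy class is the minimum of $|h|_Z$ over its elements $h$; the conjugacy growth series $\tilde\sigma_{(H,Z)}(z)$ has as coefficient of $z^n$ the number of conjugacy classes of $H$ of length $n$. *)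

theory Defs
  imports
    "HOL-Algebra.Product_Groups"
    "HOL-Algebra.Elementary_Groups"
    "HOL-Analysis.Analysis"
    "HOL-Number_Theory.Totient"
begin

definition fin_sym_gen_set :: "('a, 'b) monoid_scheme \<Rightarrow> 'a set \<Rightarrow> bool" where
  "fin_sym_gen_set H Z \<longleftrightarrow>
     finite Z \<and> Z \<subseteq> carrier H \<and> (\<forall>z\<in>Z. inv\<^bsub>H\<^esub> z \<in> Z) \<and> generate H Z = carrier H"

text \<open>Words over \<open>Z\<close> need no formal inverses, as generating sets are symmetric.\<close>

definition word_length :: "('a, 'b) monoid_scheme \<Rightarrow> 'a set \<Rightarrow> 'a \<Rightarrow> nat" where
  "word_length H Z h =
     (LEAST n. \<exists>w. set w \<subseteq> Z \<and> length w = n \<and> foldr (\<lambda>x y. x \<otimes>\<^bsub>H\<^esub> y) w \<one>\<^bsub>H\<^esub> = h)"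

definition conj_classes :: "('a, 'b) monoid_scheme \<Rightarrow> 'a set set" where
  "conj_classes H = (\<lambda>h. {x \<otimes>\<^bsub>H\<^esub> h \<otimes>\<^bsub>H\<^esub> inv\<^bsub>H\<^esub> x | x. x \<in> carrier H}) ` carrier H"

definition class_length :: "('a, 'b) monoid_scheme \<Rightarrow> 'a set \<Rightarrow> 'a set \<Rightarrow> nat" where
  "class_length H Z C = (INF h\<in>C. word_length H Z h)"

text \<open>The coefficients are counts; they are taken in \<open>real\<close> so that quotients and radii of
  convergence make sense.\<close>

definition growth_series :: "('a, 'b) monoid_scheme \<Rightarrow> 'a set \<Rightarrow> real fps" where
  "growth_series H Z = Abs_fps (\<lambda>n. real (card {h \<in> carrier H. word_length H Z h = n}))"

definition conj_growth_series :: "('a, 'b) monoid_scheme \<Rightarrow> 'a set \<Rightarrow> real fps" where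
  "conj_growth_series H Z =
     Abs_fps (\<lambda>n. real (card {C \<in> conj_classes H. class_length H Z C = n}))"

text \<open>As in \<^const>\<open>product_group\<close>, functions on \<open>L\<close> are \<open>undefined\<close> outside \<open>carrier L\<close>;
  hence the restricted abstractions below.\<close>

definition wreath_shift ::
    "('l, 'c) monoid_scheme \<Rightarrow> 'l \<Rightarrow> ('l \<Rightarrow> 'a) \<Rightarrow> 'l \<Rightarrow> 'a" where
  "wreath_shift L m \<theta> = (\<lambda>i\<in>carrier L. \<theta> (inv\<^bsub>L\<^esub> m \<otimes>\<^bsub>L\<^esub> i))"

definition wreath_product ::
    "('a, 'b) monoid_scheme \<Rightarrow> ('l, 'c) monoid_scheme \<Rightarrow> (('l \<Rightarrow> 'a) \<times> 'l) monoid" where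
  "wreath_product G L =
     \<lparr>carrier = carrier (sum_group (carrier L) (\<lambda>_. G)) \<times> carrier L,
      monoid.mult = (\<lambda>(\<eta>, m) (\<theta>, n).
        (\<eta> \<otimes>\<^bsub>sum_group (carrier L) (\<lambda>_. G)\<^esub> wreath_shift L m \<theta>, m \<otimes>\<^bsub>L\<^esub> n)),
      one = (\<one>\<^bsub>sum_group (carrier L) (\<lambda>_. G)\<^esub>, \<one>\<^bsub>L\<^esub>)\<rparr>"

definition wreath_single ::
    "('a, 'b) monoid_scheme \<Rightarrow> ('l, 'c) monoid_scheme \<Rightarrow> 'a \<Rightarrow> 'l \<Rightarrow> 'a" where
  "wreath_single G L g = (\<lambda>i\<in>carrier L. if i = \<one>\<^bsub>L\<^esub> then g else \<one>\<^bsub>G\<^esub>)"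

definition wreath_gens ::
    "('a, 'b) monoid_scheme \<Rightarrow> 'a set \<Rightarrow> ('l, 'c) monoid_scheme \<Rightarrow> 'l set
      \<Rightarrow> (('l \<Rightarrow> 'a) \<times> 'l) set" where
  "wreath_gens G Y L X =
     {(wreath_single G L \<one>\<^bsub>G\<^esub>, x) | x. x \<in> X} \<union> {(wreath_single G L y, \<one>\<^bsub>L\<^esub>) | y. y \<in> Y}"

end

theory Submission
  imports Defs "HOL-Algebra.Group_Action" "HOL-Computational_Algebra.Formal_Laurent_Series"
begin

text \<open>An element of the wreath product is a pair (\<eta>, m) of a finitely supported lamp configuration
  \<eta> on the integers and a cursor position m. Conjugation by (\<theta>, n) keeps m and replaces \<eta> i by
  \<theta> i \<eta>(i - n) \<theta>(i - m)\<inverse>, so the conjugacy classes are counted separately for each m.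

  For m > 0 the product of the lamps along a coset of the multiples of m, taken from right to left,
  is unchanged by \<theta>, because \<theta> is trivial near both ends of the coset. These products form an
  m-periodic function p with values in G, defined up to translation, and they are a complete
  invariant (\<open>conj_class_W_iff\<close>). A word for a member of the class moves the cursor at least m
  times and spends at least the lengths of the values of p over one period; the configuration
  carrying p on 0, ..., m - 1 attains this (\<open>class_length_moving\<close>). Hence these classes are
  necklaces of length m in the elements of G, each bead x having weight 1 + |x|. Burnside's lemma
  counts them (\<open>card_necklaces\<close>) and produces the sum with Euler's function, where r is the order of
  the rotation and s the length of a repeating block, m = r s. Inversion exchanges m and -m, which
  explains the factor 2.

  For m = 0 a class is a finitely supported family of conjugacy classes of G, again up to
  translation. If its support spans the positions 0, ..., w, a word must walk from end to end and
  back, so the length is 2 w plus the lengths of the classes (\<open>class_length_pattern\<close>). Only the two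
  end positions are required to be nontrivial; summing over w is a geometric series and gives the
  rational part of the formula (\<open>card_classes_still_series\<close>).

  For the radius of convergence, let \<sigma> be the standard growth series of G. Its coefficients are
  submultiplicative, which forces x \<sigma>(x) to reach 1 strictly inside the disc of convergence
  (\<open>submultiplicative_reaches_one\<close>), say at t. A necklace of length m comes from at least 1 and at
  most m words, so up to a factor n the necklace series has the coefficients of
  the geometric series in x \<sigma>(x), whose radius of convergence is t; the rational part converges for
  |x| < t as well (\<open>conv_radius_necklace_growth\<close>).\<close>

section \<open>Word length and conjugacy classes\<close>

lemma (in monoid) foldr_mult_closed: "set w \<subseteq> carrier G \<Longrightarrow> foldr (\<otimes>) w \<one> \<in> carrier G"
  by (induction w) auto

lemma (in monoid) foldr_mult_append:
  "set v \<subseteq> carrier G \<Longrightarrow> set w \<subseteq> carrier G \<Longrightarrow>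
    foldr (\<otimes>) (v @ w) \<one> = foldr (\<otimes>) v \<one> \<otimes> foldr (\<otimes>) w \<one>"
  by (induction v) (auto simp: foldr_mult_closed m_assoc)

text \<open>That every element is spelled by a word is the form in which generation is used, and the form in
  which it is shown for the wreath product.\<close>

locale word_group = group H for H (structure) +
  fixes Z :: "'a set"
  assumes finite_gens: "finite Z"
    and gens_closed: "Z \<subseteq> carrier H"
    and gens_inv: "z \<in> Z \<Longrightarrow> inv z \<in> Z"
    and spelled: "h \<in> carrier H \<Longrightarrow> \<exists>w. set w \<subseteq> Z \<and> foldr (\<otimes>) w \<one> = h"
begin

abbreviation value_of :: "'a list \<Rightarrow> 'a" where "value_of w \<equiv> foldr (\<otimes>) w \<one>"
abbreviation len :: "'a \<Rightarrow> nat" where "len \<equiv> word_length H Z"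

lemma value_of_closed: "set w \<subseteq> Z \<Longrightarrow> value_of w \<in> carrier H"
  using gens_closed by (intro foldr_mult_closed) auto

lemma value_of_append:
  "set v \<subseteq> Z \<Longrightarrow> set w \<subseteq> Z \<Longrightarrow> value_of (v @ w) = value_of v \<otimes> value_of w"
  using gens_closed by (intro foldr_mult_append) auto

lemma value_of_rev_inv:
  "set w \<subseteq> Z \<Longrightarrow> value_of (rev (map (\<lambda>z. inv z) w)) = inv (value_of w)"
proof (induction w)
  case (Cons a w)
  have w: "set w \<subseteq> Z" and a: "a \<in> carrier H" "a \<in> Z" using Cons.prems gens_closed by auto
  have "value_of (rev (map (\<lambda>z. inv z) w) @ [inv a]) = inv (value_of w) \<otimes> value_of [inv a]"
    using value_of_append[of "rev (map (\<lambda>z. inv z) w)" "[inv a]"] w a gens_inv Cons.IH by auto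
  then show ?case using a w value_of_closed[OF w] by (simp add: inv_mult_group)
qed simp

lemma len_value_of_le: "set w \<subseteq> Z \<Longrightarrow> len (value_of w) \<le> length w"
  unfolding word_length_def by (rule Least_le) blast

lemma len_le: "set w \<subseteq> Z \<Longrightarrow> value_of w = h \<Longrightarrow> length w \<le> n \<Longrightarrow> len h \<le> n"
  using len_value_of_le by fastforce

lemma geodesic_word:
  assumes "h \<in> carrier H"
  obtains w where "set w \<subseteq> Z" "length w = len h" "value_of w = h"
proof -
  have "\<exists>n w. set w \<subseteq> Z \<and> length w = n \<and> value_of w = h" using spelled[OF assms] by blast
  from LeastI_ex[OF this] show ?thesis using that unfolding word_length_def by blast
qed

lemma len_one [simp]: "len \<one> = 0"
  using len_value_of_le[of "[]"] by simp

lemma len_gen: "z \<in> Z \<Longrightarrow> len z \<le> 1"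
  using len_value_of_le[of "[z]"] gens_closed by auto

lemma len_mult_le:
  assumes "g \<in> carrier H" "h \<in> carrier H"
  shows "len (g \<otimes> h) \<le> len g + len h"
proof -
  obtain v where v: "set v \<subseteq> Z" "length v = len g" "value_of v = g" using geodesic_word assms by blast
  obtain w where w: "set w \<subseteq> Z" "length w = len h" "value_of w = h" using geodesic_word assms by blast
  show ?thesis by (rule len_le[of "v @ w"]) (use v w value_of_append in auto)
qed

lemma len_inv_le: "h \<in> carrier H \<Longrightarrow> len (inv h) \<le> len h"
proof -
  assume h: "h \<in> carrier H"
  obtain w where w: "set w \<subseteq> Z" "length w = len h" "value_of w = h" using geodesic_word h by blast
  show ?thesis by (rule len_le[of "rev (map (\<lambda>z. inv z) w)"]) (use w gens_inv value_of_rev_inv in auto)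
qed

lemma len_inv: "h \<in> carrier H \<Longrightarrow> len (inv h) = len h"
  using len_inv_le[of h] len_inv_le[of "inv h"] by simp

lemma len_eq_0_iff: "h \<in> carrier H \<Longrightarrow> len h = 0 \<longleftrightarrow> h = \<one>"
proof
  assume "h \<in> carrier H" "len h = 0"
  then obtain w where "length w = 0" "value_of w = h" using geodesic_word by metis
  then show "h = \<one>" by simp
qed simp

lemma finite_sphere: "finite {h \<in> carrier H. len h = n}"
proof (rule finite_subset)
  show "{h \<in> carrier H. len h = n} \<subseteq> value_of ` {w. set w \<subseteq> Z \<and> length w = n}"
  proof clarify
    fix h assume "h \<in> carrier H" "n = len h"
    then obtain w where "set w \<subseteq> Z" "length w = n" "value_of w = h" using geodesic_word by metis
    then show "h \<in> value_of ` {w. set w \<subseteq> Z \<and> length w = len h}"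
      using \<open>n = len h\<close> by (intro image_eqI[of _ _ w]) auto
  qed
  show "finite (value_of ` {w. set w \<subseteq> Z \<and> length w = n})"
    using finite_gens by (simp add: finite_lists_length_eq)
qed

text \<open>Cutting a geodesic word of length m + n after m letters gives two geodesic words.\<close>

lemma sphere_card_submult:
  "card {h \<in> carrier H. len h = m + n} \<le> card {h \<in> carrier H. len h = m} * card {h \<in> carrier H. len h = n}"
proof -
  let ?S = "\<lambda>n. {h \<in> carrier H. len h = n}"
  have "?S (m + n) \<subseteq> (\<lambda>(g, h). g \<otimes> h) ` (?S m \<times> ?S n)"
  proof
    fix x assume x: "x \<in> ?S (m + n)"
    then obtain w where w: "set w \<subseteq> Z" "length w = m + n" "value_of w = x"
      using geodesic_word by (metis (mono_tags, lifting) mem_Collect_eq)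
    define g h where "g = value_of (take m w)" and "h = value_of (drop m w)"
    have sub: "set (take m w) \<subseteq> Z" "set (drop m w) \<subseteq> Z"
      using w(1) by (meson set_take_subset set_drop_subset subset_trans)+
    have gh: "g \<in> carrier H" "h \<in> carrier H" "x = g \<otimes> h"
      using sub value_of_closed value_of_append[OF sub] w(3) by (auto simp: g_def h_def)
    have "len g \<le> m" "len h \<le> n"
      using len_value_of_le[OF sub(1)] len_value_of_le[OF sub(2)] w(2) by (auto simp: g_def h_def)
    moreover have "m + n \<le> len g + len h" using len_mult_le[OF gh(1,2)] gh(3) x by simp
    ultimately have "len g = m" "len h = n" by auto
    then show "x \<in> (\<lambda>(g, h). g \<otimes> h) ` (?S m \<times> ?S n)" using gh by force
  qed
  then have "card (?S (m + n)) \<le> card ((\<lambda>(g, h). g \<otimes> h) ` (?S m \<times> ?S n))"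
    using finite_sphere by (intro card_mono) auto
  also have "\<dots> \<le> card (?S m \<times> ?S n)" using finite_sphere by (intro card_image_le) auto
  finally show ?thesis by (simp add: card_cartesian_product)
qed

definition conj_class :: "'a \<Rightarrow> 'a set" where
  "conj_class h = {x \<otimes> h \<otimes> inv x | x. x \<in> carrier H}"

lemma conj_classes_eq: "conj_classes H = conj_class ` carrier H"
  by (simp add: conj_classes_def conj_class_def)

lemma conj_class_refl: "h \<in> carrier H \<Longrightarrow> h \<in> conj_class h"
  unfolding conj_class_def by (rule CollectI, rule exI[of _ \<one>]) auto

lemma conj_class_closed: "h \<in> carrier H \<Longrightarrow> conj_class h \<subseteq> carrier H"
  unfolding conj_class_def by auto

lemma conj_class_eq:
  assumes "h \<in> carrier H" "g \<in> conj_class h"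
  shows "conj_class g = conj_class h"
proof -
  obtain x where x: "x \<in> carrier H" "g = x \<otimes> h \<otimes> inv x" using assms by (auto simp: conj_class_def)
  have "y \<otimes> g \<otimes> inv y = (y \<otimes> x) \<otimes> h \<otimes> inv (y \<otimes> x)" if "y \<in> carrier H" for y
    using x assms that by (simp add: m_assoc inv_mult_group)
  moreover have "y \<otimes> h \<otimes> inv y = (y \<otimes> inv x) \<otimes> g \<otimes> inv (y \<otimes> inv x)" if "y \<in> carrier H" for y
    using x assms that by (simp add: m_assoc inv_mult_group) (simp add: m_assoc[symmetric])
  ultimately show ?thesis
    unfolding conj_class_def using x(1) by (auto; metis m_closed inv_closed)
qed

lemma conj_class_one: "conj_class \<one> = {\<one>}"
  unfolding conj_class_def by (auto intro!: exI[of _ \<one>])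

lemma conj_class_memD:
  assumes "C \<in> conj_classes H" "h \<in> C"
  shows "h \<in> carrier H" "conj_class h = C"
proof -
  obtain g where g: "g \<in> carrier H" "C = conj_class g" using assms(1) conj_classes_eq by auto
  then show "h \<in> carrier H" using conj_class_closed assms(2) by blast
  show "conj_class h = C" using conj_class_eq[OF g(1)] g(2) assms(2) by simp
qed

lemma conj_class_in: "h \<in> carrier H \<Longrightarrow> conj_class h \<in> conj_classes H"
  by (simp add: conj_classes_eq)

lemma one_class_in: "{\<one>} \<in> conj_classes H"
  using conj_class_in[of \<one>] by (simp add: conj_class_one)

lemma conj_class_nonempty: "C \<in> conj_classes H \<Longrightarrow> C \<noteq> {}"
  using conj_class_refl by (auto simp: conj_classes_eq)

lemma conj_class_with_one:
  assumes "C \<in> conj_classes H" "\<one> \<in> C" shows "C = {\<one>}"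
  using conj_class_memD(2)[OF assms] conj_class_one by simp

lemma class_length_le: "h \<in> C \<Longrightarrow> class_length H Z C \<le> len h"
  unfolding class_length_def by (rule cINF_lower) auto

lemma class_length_attained:
  assumes "C \<in> conj_classes H"
  obtains h where "h \<in> C" "len h = class_length H Z C"
proof -
  have "Inf (len ` C) \<in> len ` C"
    using conj_class_nonempty[OF assms] by (intro Inf_nat_def1) auto
  then obtain h where "h \<in> C" "Inf (len ` C) = len h" by blast
  then show ?thesis using that by (simp add: class_length_def)
qed

lemma class_length_eqI:
  assumes "C \<in> conj_classes H" "h \<in> C" "len h \<le> n" "\<And>g. g \<in> C \<Longrightarrow> n \<le> len g"
  shows "class_length H Z C = n"
proof (rule antisym)
  show "class_length H Z C \<le> n" using class_length_le[OF assms(2)] assms(3) by linarith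
  show "n \<le> class_length H Z C" using class_length_attained[OF assms(1)] assms(4) by metis
qed

lemma class_length_eq_0_iff:
  assumes "C \<in> conj_classes H"
  shows "class_length H Z C = 0 \<longleftrightarrow> C = {\<one>}"
proof
  assume "class_length H Z C = 0"
  then obtain h where h: "h \<in> C" "len h = 0" using class_length_attained[OF assms] by metis
  then have "h = \<one>" using len_eq_0_iff[OF conj_class_memD(1)[OF assms h(1)]] by simp
  then show "C = {\<one>}" using conj_class_with_one[OF assms] h(1) by simp
next
  assume "C = {\<one>}"
  then show "class_length H Z C = 0" using class_length_le[of \<one> C] by simp
qed

lemma classes_of_length_subset:
  "{C \<in> conj_classes H. class_length H Z C = n} \<subseteq> conj_class ` {h \<in> carrier H. len h = n}"
proof clarify
  fix C assume C: "C \<in> conj_classes H" and n: "n = class_length H Z C"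
  obtain h where h: "h \<in> C" "len h = class_length H Z C" using class_length_attained[OF C] .
  then show "C \<in> conj_class ` {h \<in> carrier H. len h = class_length H Z C}"
    using conj_class_memD[OF C h(1)] by (intro image_eqI[of _ _ h]) auto
qed

lemma finite_classes_of_length: "finite {C \<in> conj_classes H. class_length H Z C = n}"
  by (rule finite_subset[OF classes_of_length_subset finite_imageI[OF finite_sphere]])

lemma card_classes_le:
  "card {C \<in> conj_classes H. class_length H Z C = n} \<le> card {h \<in> carrier H. len h = n}"
  by (rule le_trans[OF card_mono[OF finite_imageI[OF finite_sphere] classes_of_length_subset]
        card_image_le[OF finite_sphere]])

text \<open>Inversion permutes the conjugacy classes and, the generating set being symmetric, keeps
  their lengths.\<close>

lemma inv_class:
  assumes "C \<in> conj_classes H"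
  shows "m_inv H ` C \<in> conj_classes H" "class_length H Z (m_inv H ` C) = class_length H Z C"
proof -
  obtain h where h: "h \<in> carrier H" "C = conj_class h" using assms by (auto simp: conj_classes_eq)
  have *: "inv (x \<otimes> h \<otimes> inv x) = x \<otimes> inv h \<otimes> inv x" if "x \<in> carrier H" for x
    using that h by (simp add: inv_mult_group m_assoc)
  have "m_inv H ` C = conj_class (inv h)"
  proof -
    have "m_inv H ` C = (\<lambda>x. inv (x \<otimes> h \<otimes> inv x)) ` carrier H"
      unfolding h(2) conj_class_def by auto
    also have "\<dots> = (\<lambda>x. x \<otimes> inv h \<otimes> inv x) ` carrier H" using * by (rule image_cong[OF refl])
    finally show ?thesis unfolding conj_class_def by auto
  qed
  then show "m_inv H ` C \<in> conj_classes H" using h by (simp add: conj_classes_eq)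
  have "len (inv x) = len x" if "x \<in> C" for x
    using len_inv[OF conj_class_memD(1)[OF assms that]] .
  then show "class_length H Z (m_inv H ` C) = class_length H Z C"
    unfolding class_length_def by (simp add: image_image)
qed

lemma inv_inv_class: "C \<in> conj_classes H \<Longrightarrow> m_inv H ` m_inv H ` C = C"
proof -
  assume C: "C \<in> conj_classes H"
  have "m_inv H ` m_inv H ` C = (\<lambda>x. x) ` C"
    unfolding image_image by (rule image_cong) (use conj_class_memD(1)[OF C] in auto)
  then show ?thesis by simp
qed

end

lemma (in group) word_groupI:
  assumes "fin_sym_gen_set G Z"
  shows "word_group G Z"
proof -
  have Z: "finite Z" "Z \<subseteq> carrier G" "\<And>z. z \<in> Z \<Longrightarrow> inv z \<in> Z" "generate G Z = carrier G"
    using assms by (auto simp: fin_sym_gen_set_def)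
  have "\<exists>w. set w \<subseteq> Z \<and> foldr (\<otimes>) w \<one> = h" if "h \<in> generate G Z" for h
    using that
  proof (induction rule: generate.induct)
    case one
    show ?case by (rule exI[of _ "[]"]) simp
  next
    case (incl h)
    show ?case by (rule exI[of _ "[h]"]) (use incl Z(2) in auto)
  next
    case (inv h)
    show ?case by (rule exI[of _ "[inv h]"]) (use inv Z(2,3) in auto)
  next
    case (eng h1 h2)
    then obtain v w where "set v \<subseteq> Z" "foldr (\<otimes>) v \<one> = h1" "set w \<subseteq> Z" "foldr (\<otimes>) w \<one> = h2"
      by blast
    then show ?case using foldr_mult_append[of v w] Z(2) by (intro exI[of _ "v @ w"]) auto
  qed
  with Z show ?thesis by unfold_locales auto
qed

section \<open>The wreath product with the integers\<close>

context word_group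
begin

abbreviation W :: "((int \<Rightarrow> 'a) \<times> int) monoid" where "W \<equiv> wreath_product H integer_group"
abbreviation V :: "((int \<Rightarrow> 'a) \<times> int) set" where "V \<equiv> wreath_gens H Z integer_group {1, -1}"

definition lamps :: "(int \<Rightarrow> 'a) set" where
  "lamps = {\<eta>. (\<forall>i. \<eta> i \<in> carrier H) \<and> finite {i. \<eta> i \<noteq> \<one>}}"

definition single :: "'a \<Rightarrow> int \<Rightarrow> 'a" where
  "single g = (\<lambda>i. if i = 0 then g else \<one>)"

text \<open>The lamp letters that a word for \<eta> must contain at the very least, cursor moves not counted.\<close>

definition lamp_len :: "(int \<Rightarrow> 'a) \<Rightarrow> nat" where
  "lamp_len \<eta> = (\<Sum>i | \<eta> i \<noteq> \<one>. len (\<eta> i))"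

lemma lamps_closed: "\<eta> \<in> lamps \<Longrightarrow> \<eta> i \<in> carrier H"
  by (simp add: lamps_def)

lemma lamps_finite: "\<eta> \<in> lamps \<Longrightarrow> finite {i. \<eta> i \<noteq> \<one>}"
  by (simp add: lamps_def)

lemma lampsI: "(\<And>i. \<eta> i \<in> carrier H) \<Longrightarrow> finite I \<Longrightarrow> (\<And>i. i \<notin> I \<Longrightarrow> \<eta> i = \<one>) \<Longrightarrow> \<eta> \<in> lamps"
  unfolding lamps_def by (auto intro: finite_subset[of _ I])

lemma lamps_shift:
  assumes "\<eta> \<in> lamps" shows "(\<lambda>i. \<eta> (i + n)) \<in> lamps" "(\<lambda>i. \<eta> (i - n)) \<in> lamps"
proof -
  show "(\<lambda>i. \<eta> (i + n)) \<in> lamps"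
    by (rule lampsI[of _ "(\<lambda>i. i - n) ` {i. \<eta> i \<noteq> \<one>}"])
      (use assms in \<open>auto simp: lamps_def image_iff\<close>)
  show "(\<lambda>i. \<eta> (i - n)) \<in> lamps"
    by (rule lampsI[of _ "(\<lambda>i. i + n) ` {i. \<eta> i \<noteq> \<one>}"])
      (use assms in \<open>auto simp: lamps_def image_iff\<close>)
qed

lemma lamps_inv: "\<eta> \<in> lamps \<Longrightarrow> (\<lambda>i. inv (\<eta> i)) \<in> lamps"
  by (rule lampsI[of _ "{i. \<eta> i \<noteq> \<one>}"]) (auto simp: lamps_def)

lemma lamps_mult: "\<eta> \<in> lamps \<Longrightarrow> \<theta> \<in> lamps \<Longrightarrow> (\<lambda>i. \<eta> i \<otimes> \<theta> i) \<in> lamps"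
  by (rule lampsI[of _ "{i. \<eta> i \<noteq> \<one>} \<union> {i. \<theta> i \<noteq> \<one>}"]) (auto simp: lamps_def)

lemma lamps_one: "(\<lambda>i. \<one>) \<in> lamps"
  by (simp add: lamps_def)

lemma lamps_single: "g \<in> carrier H \<Longrightarrow> single g \<in> lamps"
  by (rule lampsI[of _ "{0}"]) (auto simp: single_def)

lemma carrier_W: "carrier W = lamps \<times> UNIV"
  by (auto simp: wreath_product_def carrier_sum_group is_group lamps_def PiE_iff)

lemma mult_W: "(\<eta>, m) \<otimes>\<^bsub>W\<^esub> (\<theta>, n) = (\<lambda>i. \<eta> i \<otimes> \<theta> (i - m), m + n)"
  by (auto simp: wreath_product_def wreath_shift_def algebra_simps)

lemma one_W: "\<one>\<^bsub>W\<^esub> = (\<lambda>i. \<one>, 0)"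
  by (simp add: wreath_product_def restrict_def)

lemma group_W: "group W"
proof (rule groupI)
  fix x y z assume "x \<in> carrier W" "y \<in> carrier W" "z \<in> carrier W"
  then show "x \<otimes>\<^bsub>W\<^esub> y \<otimes>\<^bsub>W\<^esub> z = x \<otimes>\<^bsub>W\<^esub> (y \<otimes>\<^bsub>W\<^esub> z)"
    by (cases x; cases y; cases z)
      (auto simp: carrier_W mult_W m_assoc lamps_closed fun_eq_iff algebra_simps)
next
  fix x assume x: "x \<in> carrier W"
  obtain \<eta> m where e: "x = (\<eta>, m)" by force
  show "\<one>\<^bsub>W\<^esub> \<otimes>\<^bsub>W\<^esub> x = x" using x e by (auto simp: one_W mult_W carrier_W lamps_closed)
  show "\<exists>y\<in>carrier W. y \<otimes>\<^bsub>W\<^esub> x = \<one>\<^bsub>W\<^esub>"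
    using x e by (intro bexI[of _ "(\<lambda>i. inv (\<eta> (i + m)), -m)"])
      (auto simp: mult_W one_W carrier_W lamps_closed lamps_inv lamps_shift)
qed (auto simp: carrier_W mult_W one_W lamps_one lamps_mult lamps_shift)

lemma inv_W: "\<eta> \<in> lamps \<Longrightarrow> inv\<^bsub>W\<^esub> (\<eta>, m) = (\<lambda>i. inv (\<eta> (i + m)), -m)"
  by (rule group.inv_equality[OF group_W])
    (auto simp: mult_W one_W carrier_W lamps_closed lamps_inv lamps_shift)

lemma gens_W: "V = {(\<lambda>i. \<one>, 1), (\<lambda>i. \<one>, -1)} \<union> (\<lambda>y. (single y, 0)) ` Z"
proof -
  have "wreath_single H integer_group g = single g" for g
    by (simp add: wreath_single_def single_def restrict_def)
  moreover have "single \<one> = (\<lambda>i. \<one>)" by (auto simp: single_def)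
  ultimately show ?thesis by (auto simp: wreath_gens_def)
qed

lemma gens_W_closed: "V \<subseteq> carrier W"
  using gens_closed by (auto simp: gens_W carrier_W lamps_one lamps_single)

lemma lamp_len_eq:
  assumes "finite I" "\<And>i. i \<notin> I \<Longrightarrow> \<eta> i = \<one>"
  shows "lamp_len \<eta> = (\<Sum>i\<in>I. len (\<eta> i))"
  unfolding lamp_len_def by (rule sum.mono_neutral_left) (use assms in auto)

lemma lamp_len_shift: "lamp_len (\<lambda>i. \<eta> (i - n)) = lamp_len \<eta>"
  unfolding lamp_len_def
  by (rule sum.reindex_bij_witness[of _ "\<lambda>i. i + n" "\<lambda>i. i - n"]) auto

subsection \<open>Upper bounds for the word length\<close>

text \<open>Upper bounds are stated with explicit words: as long as it is not known that every element of the
  wreath product is spelled, its word length is the minimum of a possibly empty set.\<close>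

definition reach :: "nat \<Rightarrow> (int \<Rightarrow> 'a) \<times> int \<Rightarrow> bool" where
  "reach n h \<longleftrightarrow> (\<exists>w. set w \<subseteq> V \<and> length w \<le> n \<and> foldr (\<otimes>\<^bsub>W\<^esub>) w \<one>\<^bsub>W\<^esub> = h)"

lemma reach_mult: "reach a g \<Longrightarrow> reach b h \<Longrightarrow> reach (a + b) (g \<otimes>\<^bsub>W\<^esub> h)"
proof -
  assume "reach a g" "reach b h"
  then obtain v w where "set v \<subseteq> V" "length v \<le> a" "foldr (\<otimes>\<^bsub>W\<^esub>) v \<one>\<^bsub>W\<^esub> = g"
    "set w \<subseteq> V" "length w \<le> b" "foldr (\<otimes>\<^bsub>W\<^esub>) w \<one>\<^bsub>W\<^esub> = h"
    unfolding reach_def by blast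
  then show ?thesis
    unfolding reach_def using gens_W_closed group_W
    by (intro exI[of _ "v @ w"]) (auto simp: group_def monoid.foldr_mult_append subset_trans simp del: foldr_append)
qed

lemma reach_single:
  assumes "g \<in> carrier H" shows "reach (len g) (single g, 0)"
proof -
  obtain w where w: "set w \<subseteq> Z" "length w = len g" "value_of w = g" using geodesic_word assms by metis
  have "set w \<subseteq> Z \<Longrightarrow> foldr (\<otimes>\<^bsub>W\<^esub>) (map (\<lambda>y. (single y, 0)) w) \<one>\<^bsub>W\<^esub> = (single (value_of w), 0)"
    by (induction w) (auto simp: one_W mult_W single_def)
  then show ?thesis
    unfolding reach_def using w by (intro exI[of _ "map (\<lambda>y. (single y, 0)) w"]) (auto simp: gens_W)
qed

lemma reach_move: "reach (nat \<bar>k\<bar>) (\<lambda>i. \<one>, k)"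
proof -
  have 1: "foldr (\<otimes>\<^bsub>W\<^esub>) (replicate n (\<lambda>i. \<one>, s)) \<one>\<^bsub>W\<^esub> = (\<lambda>i. \<one>, int n * s)" for n s
    by (induction n) (auto simp: one_W mult_W algebra_simps)
  show ?thesis
    unfolding reach_def
    by (rule exI[of _ "replicate (nat \<bar>k\<bar>) (\<lambda>i. \<one>, sgn k)"])
      (auto simp: 1 gens_W sgn_if abs_if simp del: foldr_replicate split: if_splits)
qed

text \<open>The word sets the lamp at the cursor and moves one step to the right, w times.\<close>

lemma reach_strip:
  assumes "\<eta> \<in> lamps" "\<And>i. i < 0 \<or> i > int w \<Longrightarrow> \<eta> i = \<one>"
  shows "reach (w + (\<Sum>i\<le>w. len (\<eta> (int i)))) (\<eta>, int w)"
  using assms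
proof (induction w arbitrary: \<eta>)
  case 0
  then have "\<eta> = single (\<eta> 0)" by (auto simp: single_def fun_eq_iff) (metis not_less_iff_gr_or_eq)
  then show ?case using reach_single[of "\<eta> 0"] lamps_closed 0 by simp
next
  case (Suc w)
  define \<theta> where "\<theta> = (\<lambda>i. if i < 0 then \<one> else \<eta> (i + 1))"
  have \<theta>: "\<theta> \<in> lamps" "\<And>i. i < 0 \<or> i > int w \<Longrightarrow> \<theta> i = \<one>"
    using Suc.prems by (auto simp: \<theta>_def lamps_closed intro!: lampsI[of _ "{0..int w}"])
  have "reach (len (\<eta> 0) + nat \<bar>1\<bar> + (w + (\<Sum>i\<le>w. len (\<theta> (int i)))))
     ((single (\<eta> 0), 0) \<otimes>\<^bsub>W\<^esub> (\<lambda>i. \<one>, 1) \<otimes>\<^bsub>W\<^esub> (\<theta>, int w))"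
    by (intro reach_mult reach_single reach_move Suc.IH \<theta>) (use Suc.prems lamps_closed in auto)
  also have "(single (\<eta> 0), 0) \<otimes>\<^bsub>W\<^esub> (\<lambda>i. \<one>, 1) \<otimes>\<^bsub>W\<^esub> (\<theta>, int w) = (\<eta>, int (Suc w))"
    using Suc.prems lamps_closed[OF Suc.prems(1)] lamps_closed[OF \<theta>(1)]
    by (auto simp: mult_W single_def \<theta>_def fun_eq_iff)
  also have "len (\<eta> 0) + nat \<bar>1\<bar> + (w + (\<Sum>i\<le>w. len (\<theta> (int i)))) = Suc w + (\<Sum>i\<le>Suc w. len (\<eta> (int i)))"
    by (subst sum.atMost_Suc_shift) (simp add: \<theta>_def add.commute)
  finally show ?case .
qed

lemma bounded_support:
  assumes "\<eta> \<in> lamps"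
  obtains N :: nat where "\<And>i. i < - int N \<or> i > int N \<Longrightarrow> \<eta> i = \<one>"
proof -
  obtain N where N: "\<And>i. i \<in> (\<lambda>i. nat \<bar>i\<bar>) ` {i. \<eta> i \<noteq> \<one>} \<Longrightarrow> i \<le> N"
    using lamps_finite[OF assms] by (metis finite_imageI finite_nat_set_iff_bounded_le)
  have "\<eta> i = \<one>" if "i < - int N \<or> i > int N" for i
    using N[of "nat \<bar>i\<bar>"] that by (cases "\<eta> i = \<one>") auto
  then show ?thesis using that by blast
qed

text \<open>An arbitrary element is reached by walking to the left end of the support, sweeping over it, and
  walking to the final position.\<close>

lemma word_group_W: "word_group W V"
proof (intro word_group.intro group_W word_group_axioms.intro)
  show "finite V" using finite_gens by (simp add: gens_W)
  show "V \<subseteq> carrier W" by (rule gens_W_closed)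
  have "(\<lambda>i. inv (single y i)) = single (inv y)" for y by (auto simp: single_def)
  then show "inv\<^bsub>W\<^esub> z \<in> V" if "z \<in> V" for z
    using that gens_closed gens_inv by (auto simp: gens_W inv_W lamps_one lamps_single)
next
  fix h assume "h \<in> carrier W"
  then obtain \<eta> m where h: "h = (\<eta>, m)" "\<eta> \<in> lamps" by (auto simp: carrier_W)
  obtain N where N: "\<And>i. i < - int N \<or> i > int N \<Longrightarrow> \<eta> i = \<one>" using bounded_support[OF h(2)] by blast
  have "\<exists>k. reach k (\<lambda>i. \<eta> (i - int N), int (2 * N))"
    by (rule exI, rule reach_strip) (use N h lamps_shift in auto)
  then obtain k where "reach k (\<lambda>i. \<eta> (i - int N), int (2 * N))" ..
  from reach_mult[OF reach_mult[OF reach_move[of "- int N"] this] reach_move[of "m - int N"]]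
  have "\<exists>k. reach k (\<eta>, m)" using h lamps_closed by (auto simp: mult_W)
  then show "\<exists>w. set w \<subseteq> V \<and> foldr (\<otimes>\<^bsub>W\<^esub>) w \<one>\<^bsub>W\<^esub> = h" unfolding reach_def h by blast
qed

lemma len_W_le_reach: "reach n h \<Longrightarrow> word_length W V h \<le> n"
  unfolding reach_def using word_group.len_le[OF word_group_W] by blast

subsection \<open>Lower bounds for the word length\<close>

text \<open>The number k counts the cursor moves. A path of the cursor from 0 to m that visits a and b visits
  one of them first, so it is no shorter than one of the two tours in the minimum. The induction
  prepends a letter: a lamp letter acts at position 0, and a move translates the rest of the path.
  The origin is admitted as a or b because a lamp letter may put 0 into the support.\<close>

lemma tour_bound:
  assumes "set w \<subseteq> V" "foldr (\<otimes>\<^bsub>W\<^esub>) w \<one>\<^bsub>W\<^esub> = (\<eta>, m)"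
  shows "\<exists>k. k + lamp_len \<eta> \<le> length w \<and>
     (\<forall>a b. a = 0 \<or> \<eta> a \<noteq> \<one> \<longrightarrow> b = 0 \<or> \<eta> b \<noteq> \<one> \<longrightarrow>
        min (\<bar>a\<bar> + \<bar>b - a\<bar> + \<bar>m - b\<bar>) (\<bar>b\<bar> + \<bar>b - a\<bar> + \<bar>m - a\<bar>) \<le> int k)"
  using assms
proof (induction w arbitrary: \<eta> m)
  case Nil
  then show ?case by (auto simp: one_W lamp_len_def)
next
  case (Cons g w)
  interpret W: word_group W V by (rule word_group_W)
  obtain \<theta> n where tn: "W.value_of w = (\<theta>, n)" by force
  have w: "set w \<subseteq> V" and g: "g \<in> V" using Cons.prems by auto
  have \<theta>: "\<theta> \<in> lamps" using W.value_of_closed[OF w] tn by (simp add: carrier_W)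
  have eq: "g \<otimes>\<^bsub>W\<^esub> (\<theta>, n) = (\<eta>, m)" using Cons.prems(2) tn by simp
  obtain k where k: "k + lamp_len \<theta> \<le> length w" and
    kk: "\<And>a b. a = 0 \<or> \<theta> a \<noteq> \<one> \<Longrightarrow> b = 0 \<or> \<theta> b \<noteq> \<one> \<Longrightarrow>
      min (\<bar>a\<bar> + \<bar>b - a\<bar> + \<bar>n - b\<bar>) (\<bar>b\<bar> + \<bar>b - a\<bar> + \<bar>n - a\<bar>) \<le> int k"
    using Cons.IH[OF w tn] by blast
  from g consider (move) x :: int where "\<bar>x\<bar> = 1" "g = (\<lambda>i. \<one>, x)" | (lamp) y where "y \<in> Z" "g = (single y, 0)"
    by (auto simp: gens_W)
  then show ?case
  proof cases
    case move
    have e: "\<eta> = (\<lambda>i. \<theta> (i - x))" "m = x + n" using eq \<theta> by (auto simp: move mult_W lamps_closed)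
    have "min (\<bar>a\<bar> + \<bar>b - a\<bar> + \<bar>m - b\<bar>) (\<bar>b\<bar> + \<bar>b - a\<bar> + \<bar>m - a\<bar>) \<le> int (Suc k)"
      if a: "a = 0 \<or> \<theta> (a - x) \<noteq> \<one>" and b: "b = 0 \<or> \<theta> (b - x) \<noteq> \<one>" for a b
    proof -
      have 0: "\<bar>n\<bar> \<le> int k" using kk[of 0 0] by simp
      have A: "\<bar>a - x\<bar> + \<bar>n - (a - x)\<bar> \<le> int k" if "a \<noteq> 0" using kk[of "a - x" "a - x"] a that by simp
      have B: "\<bar>b - x\<bar> + \<bar>n - (b - x)\<bar> \<le> int k" if "b \<noteq> 0" using kk[of "b - x" "b - x"] b that by simp
      have C: "min (\<bar>a-x\<bar> + \<bar>b - a\<bar> + \<bar>n - (b-x)\<bar>) (\<bar>b-x\<bar> + \<bar>b - a\<bar> + \<bar>n - (a-x)\<bar>) \<le> int k" if "a \<noteq> 0" "b \<noteq> 0"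
        using kk[of "a - x" "b - x"] a b that by simp
      have x: "\<bar>t\<bar> \<le> \<bar>t - x\<bar> + 1" for t using move(1) by linarith
      have n: "m - b = n - (b - x)" "m - a = n - (a - x)" using e by auto
      have mx: "\<bar>m\<bar> \<le> \<bar>n\<bar> + 1" using e move(1) by linarith
      show ?thesis
      proof (cases "a = 0")
        case True
        have "\<bar>b\<bar> + \<bar>m - b\<bar> \<le> int (Suc k)" if "b \<noteq> 0"
          using B[OF that] x[of b] unfolding n by linarith
        then show ?thesis using True 0 mx by (cases "b = 0") (auto simp: min_le_iff_disj)
      next
        case False
        have "\<bar>a\<bar> + \<bar>m - a\<bar> \<le> int (Suc k)" if "a \<noteq> 0"
          using A[OF that] x[of a] unfolding n by linarith
        moreover have "min (\<bar>a\<bar> + \<bar>b - a\<bar> + \<bar>m - b\<bar>) (\<bar>b\<bar> + \<bar>b - a\<bar> + \<bar>m - a\<bar>) \<le> int (Suc k)"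
          if "b \<noteq> 0"
          using C[OF False that] x[of a] x[of b] unfolding n min_le_iff_disj by linarith
        ultimately show ?thesis using False by (cases "b = 0") (auto simp: min_le_iff_disj)
      qed
    qed
    moreover have "Suc k + lamp_len \<eta> \<le> length (g # w)" using k by (simp add: e lamp_len_shift)
    ultimately show ?thesis unfolding e(1) by blast
  next
    case lamp
    have e1: "\<eta> = (\<lambda>i. single y i \<otimes> \<theta> i)" "m = n" using eq by (auto simp: lamp mult_W)
    have e: "\<eta> = \<theta>(0 := y \<otimes> \<theta> 0)" "m = n"
      using lamps_closed[OF \<theta>] by (auto simp: e1 single_def fun_eq_iff)
    define I where "I = insert 0 {i. \<theta> i \<noteq> \<one>}"
    have I: "finite I" using lamps_finite[OF \<theta>] by (simp add: I_def)
    have "lamp_len \<theta> = (\<Sum>i\<in>I. len (\<theta> i))" by (rule lamp_len_eq[OF I]) (auto simp: I_def)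
    also have "\<dots> = len (\<theta> 0) + (\<Sum>i\<in>I - {0}. len (\<theta> i))"
      by (rule sum.remove[OF I]) (simp add: I_def)
    finally have t: "lamp_len \<theta> = len (\<theta> 0) + (\<Sum>i\<in>I - {0}. len (\<theta> i))" .
    have "lamp_len \<eta> = (\<Sum>i\<in>I. len (\<eta> i))" by (rule lamp_len_eq[OF I]) (auto simp: e I_def)
    also have "\<dots> = len (y \<otimes> \<theta> 0) + (\<Sum>i\<in>I - {0}. len (\<theta> i))"
      using I by (subst sum.remove[of _ 0]) (auto simp: I_def e)
    also have "len (y \<otimes> \<theta> 0) \<le> 1 + len (\<theta> 0)"
      using len_mult_le[of y "\<theta> 0"] len_gen[OF lamp(1)] gens_closed lamp(1) lamps_closed[OF \<theta>] by force
    also have "1 + len (\<theta> 0) + (\<Sum>i\<in>I - {0}. len (\<theta> i)) = 1 + lamp_len \<theta>"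
      by (simp add: t)
    finally have "k + lamp_len \<eta> \<le> length (g # w)" using k by simp
    moreover have "min (\<bar>a\<bar> + \<bar>b - a\<bar> + \<bar>m - b\<bar>) (\<bar>b\<bar> + \<bar>b - a\<bar> + \<bar>m - a\<bar>) \<le> int k"
      if "a = 0 \<or> \<eta> a \<noteq> \<one>" "b = 0 \<or> \<eta> b \<noteq> \<one>" for a b
      unfolding e(2) by (rule kk) (use that in \<open>auto simp: e(1) split: if_splits\<close>)
    ultimately show ?thesis by blast
  qed
qed

lemma len_W_ge:
  assumes "\<eta> \<in> lamps"
  shows len_W_ge_cursor: "nat \<bar>m\<bar> + lamp_len \<eta> \<le> word_length W V (\<eta>, m)"
    and len_W_ge_span: "\<eta> a \<noteq> \<one> \<Longrightarrow> \<eta> b \<noteq> \<one> \<Longrightarrow> 2 * nat (b - a) + lamp_len \<eta> \<le> word_length W V (\<eta>, 0)"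
proof -
  interpret W: word_group W V by (rule word_group_W)
  have *: "\<exists>k. k + lamp_len \<eta> \<le> W.len (\<eta>, m) \<and>
     (\<forall>a b. a = 0 \<or> \<eta> a \<noteq> \<one> \<longrightarrow> b = 0 \<or> \<eta> b \<noteq> \<one> \<longrightarrow>
        min (\<bar>a\<bar> + \<bar>b - a\<bar> + \<bar>m - b\<bar>) (\<bar>b\<bar> + \<bar>b - a\<bar> + \<bar>m - a\<bar>) \<le> int k)" for m
  proof -
    obtain w where w: "set w \<subseteq> V" "length w = W.len (\<eta>, m)" "W.value_of w = (\<eta>, m)"
      using W.geodesic_word[of "(\<eta>, m)"] assms by (auto simp: carrier_W)
    show ?thesis using tour_bound[OF w(1,3)] w(2) by simp
  qed
  obtain k where k: "k + lamp_len \<eta> \<le> W.len (\<eta>, m)"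
    "min (\<bar>0\<bar> + \<bar>0 - 0\<bar> + \<bar>m - 0\<bar>) (\<bar>0\<bar> + \<bar>0 - 0\<bar> + \<bar>m - 0\<bar>) \<le> int k"
    using *[of m] by blast
  then show "nat \<bar>m\<bar> + lamp_len \<eta> \<le> W.len (\<eta>, m)" by simp
  assume "\<eta> a \<noteq> \<one>" "\<eta> b \<noteq> \<one>"
  then obtain k where k: "k + lamp_len \<eta> \<le> W.len (\<eta>, 0)"
    "min (\<bar>a\<bar> + \<bar>b - a\<bar> + \<bar>0 - b\<bar>) (\<bar>b\<bar> + \<bar>b - a\<bar> + \<bar>0 - a\<bar>) \<le> int k"
    using *[of 0] by blast
  then have "2 * nat (b - a) \<le> k" by linarith
  then show "2 * nat (b - a) + lamp_len \<eta> \<le> W.len (\<eta>, 0)" using k(1) by simp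
qed

text \<open>The cursor part n of the conjugating element translates the configuration; its lamp part \<theta> acts
  on the left at i and, after the move by m, on the right at i - m.\<close>

lemma conj_class_W:
  assumes "\<eta> \<in> lamps"
  shows "word_group.conj_class W (\<eta>, m) =
    {(\<lambda>i. \<theta> i \<otimes> \<eta> (i - n) \<otimes> inv (\<theta> (i - m)), m) | \<theta> n. \<theta> \<in> lamps}"
proof -
  interpret W: word_group W V by (rule word_group_W)
  have *: "(\<theta>, n) \<otimes>\<^bsub>W\<^esub> (\<eta>, m) \<otimes>\<^bsub>W\<^esub> inv\<^bsub>W\<^esub> (\<theta>, n) = (\<lambda>i. \<theta> i \<otimes> \<eta> (i - n) \<otimes> inv (\<theta> (i - m)), m)"
    if "\<theta> \<in> lamps" for \<theta> n
    using that by (simp add: inv_W mult_W algebra_simps)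
  show ?thesis unfolding W.conj_class_def carrier_W by (force simp: *)
qed

end

section \<open>Counting necklaces\<close>

text \<open>Words on a cycle of length m are encoded as m-periodic functions on the integers. Rotations are
  then translations, and the words fixed by a rotation are the functions with a smaller period,
  without a change of type.\<close>

definition periodic :: "'a set \<Rightarrow> nat \<Rightarrow> (int \<Rightarrow> 'a) set" where
  "periodic A m = {p. (\<forall>i. p i \<in> A) \<and> (\<forall>i. p (i + int m) = p i)}"

definition weight :: "('a \<Rightarrow> nat) \<Rightarrow> nat \<Rightarrow> (int \<Rightarrow> 'a) \<Rightarrow> nat" where
  "weight l m p = (\<Sum>i<m. l (p (int i)))"

definition translates :: "(int \<Rightarrow> 'a) \<Rightarrow> (int \<Rightarrow> 'a) set" where
  "translates p = {\<lambda>i. p (i + j) | j. True}"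

definition necklaces :: "'a set \<Rightarrow> ('a \<Rightarrow> nat) \<Rightarrow> nat \<Rightarrow> nat \<Rightarrow> (int \<Rightarrow> 'a) set set" where
  "necklaces A l m k = translates ` {p \<in> periodic A m. weight l m p = k}"

text \<open>The generating function of A by l; the growth series of a group and the conjugacy growth series are
  instances.\<close>

definition weight_series :: "'a set \<Rightarrow> ('a \<Rightarrow> nat) \<Rightarrow> real fps" where
  "weight_series A l = Abs_fps (\<lambda>n. real (card {x \<in> A. l x = n}))"

lemma periodic_mult:
  assumes "\<And>i. p (i + c) = p i" shows "p (i + c * k) = p (i :: int)"
proof -
  have 1: "p (i + c * int n) = p i" for i n
  proof (induction n)
    case (Suc n)
    have "p (i + c * int (Suc n)) = p ((i + c * int n) + c)" by (simp add: algebra_simps)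
    then show ?case using assms Suc by simp
  qed simp
  show ?thesis
  proof (cases "k \<ge> 0")
    case True
    then show ?thesis using 1[of i "nat k"] by simp
  next
    case False
    then show ?thesis using 1[of "i + c * k" "nat (-k)"] by simp
  qed
qed

lemma periodic_mod:
  assumes "\<And>i. p (i + int m) = p i" shows "p (i mod int m) = p i"
  using periodic_mult[of p "int m" "i mod int m" "i div int m", OF assms] by (simp add: add.commute)

text \<open>The sum is over a complete residue system modulo m.\<close>

lemma sum_translate_periodic:
  fixes f :: "int \<Rightarrow> nat"
  assumes "\<And>i. f (i + int m) = f i"
  shows "(\<Sum>i<m. f (int i + c)) = (\<Sum>i<m. f (int i))"
proof (cases "m = 0")
  case False
  have mod: "f (i mod int m) = f i" for i using assms by (intro periodic_mod) simp
  have eq: "(\<Sum>i<m. f (int i + c)) = (\<Sum>i\<in>{0..<int m}. f (i + c))" for c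
    by (rule sum.reindex_bij_witness[of _ nat int]) auto
  have "(\<Sum>i\<in>{0..<int m}. f (i + c)) = (\<Sum>i\<in>{0..<int m}. f i)"
    by (rule sum.reindex_bij_witness[of _ "\<lambda>i. (i - c) mod int m" "\<lambda>i. (i + c) mod int m"])
      (use False mod in \<open>auto simp: mod_simps\<close>)
  then show ?thesis using eq[of c] eq[of 0] by simp
qed simp

lemma periodic_translate: "p \<in> periodic A m \<Longrightarrow> (\<lambda>i. p (i + j)) \<in> periodic A m"
  unfolding periodic_def by (auto simp: algebra_simps) (metis add.commute add.left_commute)

lemma weight_translate: "p \<in> periodic A m \<Longrightarrow> weight l m (\<lambda>i. p (i + j)) = weight l m p"
  unfolding weight_def using sum_translate_periodic[of "\<lambda>i. l (p i)" m j] by (simp add: periodic_def)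

lemma translates_refl: "p \<in> translates p"
  unfolding translates_def by (rule CollectI, rule exI[of _ 0]) simp

text \<open>The periods of p form a subgroup of the integers, so the periods j and m together amount to the
  single period gcd j m.\<close>

lemma periodic_gcd:
  "periodic A m \<inter> {p. (\<lambda>i. p (i + int j)) = p} = periodic A (gcd j m)"
proof (intro equalityI subsetI)
  fix p assume "p \<in> periodic A m \<inter> {p. (\<lambda>i. p (i + int j)) = p}"
  then have p: "\<And>i. p i \<in> A" "\<And>i. p (i + int m) = p i" "\<And>i. p (i + int j) = p i"
    by (auto simp: periodic_def fun_eq_iff)
  obtain u v where uv: "u * int j + v * int m = gcd (int j) (int m)" using bezout_int by blast
  have "p (i + int (gcd j m)) = p i" for i
  proof -
    have "p (i + int (gcd j m)) = p ((i + int j * u) + int m * v)"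
      using uv by (simp add: algebra_simps)
    then show ?thesis by (simp add: periodic_mult[of p, OF p(2)] periodic_mult[of p, OF p(3)])
  qed
  then show "p \<in> periodic A (gcd j m)" using p(1) by (simp add: periodic_def)
next
  fix p assume p: "p \<in> periodic A (gcd j m)"
  then have per: "\<And>i. p (i + int (gcd j m)) = p i" by (simp add: periodic_def)
  have "p (i + int n) = p i" if dvd: "gcd j m dvd n" for n i
  proof -
    obtain k where "n = gcd j m * k" using dvd by blast
    then show ?thesis using periodic_mult[of p "int (gcd j m)" i "int k", OF per] by simp
  qed
  then show "p \<in> periodic A m \<inter> {p. (\<lambda>i. p (i + int j)) = p}"
    using p by (auto simp: periodic_def)
qed

lemma weight_multiple:
  assumes "p \<in> periodic A d" shows "weight l (r * d) p = r * weight l d p"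
proof (induction r)
  case (Suc r)
  have per: "\<And>i. p (i + int d) = p i" using assms by (simp add: periodic_def)
  have "weight l (Suc r * d) p = (\<Sum>i<d + r * d. l (p (int i)))" by (simp add: weight_def)
  also have "\<dots> = (\<Sum>i<r * d. l (p (int i))) + (\<Sum>i<d. l (p (int (i + r * d))))"
    using sum.atLeastLessThan_concat[of 0 "r * d" "d + r * d" "\<lambda>i. l (p (int i))"]
      sum.shift_bounds_nat_ivl[of "\<lambda>i. l (p (int i))" 0 "r * d" d]
    by (simp only: lessThan_atLeast0 add_0 le_add2 zero_le)
  also have "(\<Sum>i<d. l (p (int (i + r * d)))) = weight l d p"
    unfolding weight_def using periodic_mult[of p "int d" _ "int r", OF per]
    by (intro sum.cong) (simp_all add: mult.commute)
  finally show ?case using Suc by (simp add: weight_def)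
qed (simp add: weight_def)

text \<open>A product of generating functions counts families by total weight. The value d off the index
  set is arbitrary, but fixed, so that a family is determined by its restriction to I.\<close>

lemma card_weighted_functions:
  fixes d :: 'b and A :: "'i \<Rightarrow> 'b set"
  assumes "finite I" "\<And>i n. i \<in> I \<Longrightarrow> finite {x \<in> A i. l x = n}"
  shows "finite {f. (\<forall>i\<in>I. f i \<in> A i) \<and> (\<forall>i. i \<notin> I \<longrightarrow> f i = d) \<and> (\<Sum>i\<in>I. l (f i)) = n} \<and>
    real (card {f. (\<forall>i\<in>I. f i \<in> A i) \<and> (\<forall>i. i \<notin> I \<longrightarrow> f i = d) \<and> (\<Sum>i\<in>I. l (f i)) = n})
      = fps_nth (\<Prod>i\<in>I. weight_series (A i) l) n"
  using assms
proof (induction I arbitrary: n rule: finite_induct)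
  case empty
  have "{f :: 'i \<Rightarrow> 'b. (\<forall>i. f i = d) \<and> 0 = n} = (if n = 0 then {\<lambda>i. d} else {})" by auto
  then show ?case by simp
next
  case (insert j I)
  let ?F = "\<lambda>I n. {f. (\<forall>i\<in>I. f i \<in> A i) \<and> (\<forall>i. i \<notin> I \<longrightarrow> f i = d) \<and> (\<Sum>i\<in>I. l (f i)) = n}"
  let ?D = "SIGMA k:{0..n}. {x \<in> A j. l x = k} \<times> ?F I (n - k)"
  have IH: "finite (?F I n)" "real (card (?F I n)) = fps_nth (\<Prod>i\<in>I. weight_series (A i) l) n" for n
    using insert.IH insert.prems by auto
  have sumI: "(\<Sum>i\<in>I. l (if i = j then x else f i)) = (\<Sum>i\<in>I. l (f i))" for f x
    by (rule sum.cong) (use insert.hyps in auto)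
  have bij: "bij_betw (\<lambda>(k, x, f). f(j := x)) ?D (?F (insert j I) n)"
    by (rule bij_betw_byWitness[where f' = "\<lambda>f. (l (f j), f j, f(j := d))"])
      (use insert.hyps in \<open>auto simp: fun_upd_def sumI fun_eq_iff\<close>)
  have fin: "finite ?D" using IH(1) insert.prems by auto
  have "real (card (?F (insert j I) n)) = real (card ?D)"
    using bij_betw_same_card[OF bij] by simp
  also have "\<dots> = (\<Sum>k=0..n. real (card {x \<in> A j. l x = k}) * real (card (?F I (n - k))))"
    using IH(1) insert.prems by (subst card_SigmaI) (auto simp: card_cartesian_product)
  also have "\<dots> = fps_nth (weight_series (A j) l * (\<Prod>i\<in>I. weight_series (A i) l)) n"
    unfolding fps_mult_nth IH(2) by (simp add: weight_series_def)
  finally show ?case using bij_betw_finite[OF bij] fin insert.hyps by simp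
qed

locale weighted_alphabet =
  fixes A :: "'a set" and l :: "'a \<Rightarrow> nat"
  assumes finite_level: "finite {x \<in> A. l x = n}"
begin

lemma card_periodic:
  assumes "d > 0"
  shows "finite {p \<in> periodic A d. weight l d p = k}"
    "real (card {p \<in> periodic A d. weight l d p = k}) = fps_nth (weight_series A l ^ d) k"
proof -
  let ?F = "{f. (\<forall>i\<in>{..<d}. f i \<in> A) \<and> (\<forall>i. i \<notin> {..<d} \<longrightarrow> f i = undefined) \<and> (\<Sum>i\<in>{..<d}. l (f i)) = k}"
  have "bij_betw (\<lambda>p i. if i < d then p (int i) else undefined) {p \<in> periodic A d. weight l d p = k} ?F"
  proof (rule bij_betw_byWitness[where f' = "\<lambda>f i. f (nat (i mod int d))"])
    show "\<forall>p\<in>{p \<in> periodic A d. weight l d p = k}.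
        (\<lambda>i. (\<lambda>i. if i < d then p (int i) else undefined) (nat (i mod int d))) = p"
    proof
      fix p assume "p \<in> {p \<in> periodic A d. weight l d p = k}"
      then have "p (i mod int d) = p i" for i by (intro periodic_mod) (simp add: periodic_def)
      then show "(\<lambda>i. (\<lambda>i. if i < d then p (int i) else undefined) (nat (i mod int d))) = p"
        using assms by (auto simp: fun_eq_iff nat_less_iff)
    qed
    show "(\<lambda>f i. f (nat (i mod int d))) ` ?F \<subseteq> {p \<in> periodic A d. weight l d p = k}"
      using assms by (auto simp: periodic_def weight_def nat_less_iff)
  qed (use assms in \<open>auto simp: periodic_def weight_def fun_eq_iff\<close>)
  moreover note card_weighted_functions[where I="{..<d}" and A="\<lambda>i. A" and l=l and n=k and d=undefined, OF finite_lessThan finite_level]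
  ultimately show "finite {p \<in> periodic A d. weight l d p = k}"
    "real (card {p \<in> periodic A d. weight l d p = k}) = fps_nth (weight_series A l ^ d) k"
    by (auto simp: bij_betw_finite dest: bij_betw_same_card)
qed

text \<open>A word of length r d that repeats with period d carries r times the weight of one block, hence
  the substitution of x^r.\<close>

lemma card_fixed:
  assumes "r > 0" "d > 0"
  shows "real (card {p \<in> periodic A d. weight l (r * d) p = k}) =
    fps_nth ((weight_series A l oo fps_X ^ r) ^ d) k"
proof -
  have "{p \<in> periodic A d. weight l (r * d) p = k} =
     (if r dvd k then {p \<in> periodic A d. weight l d p = k div r} else {})"
    using assms weight_multiple[of _ A d l r] by (auto simp: dvd_def)
  moreover have "(weight_series A l oo fps_X ^ r) ^ d = (weight_series A l ^ d) oo fps_X ^ r"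
    using assms by (intro fps_compose_power) auto
  ultimately show ?thesis using card_periodic(2)[OF assms(2)] by (auto simp: fps_nth_compose_X_power)
qed

text \<open>Burnside's lemma, for the action of the integers modulo m by translation on the functions of
  period m and weight k.\<close>

lemma burnside_necklaces:
  assumes "m > 0"
  shows "finite (necklaces A l m k)"
    "card (necklaces A l m k) * m = (\<Sum>j<m. card {p \<in> periodic A (gcd j m). weight l m p = k})"
proof -
  define E where "E = {p \<in> periodic A m. weight l m p = k}"
  define \<phi> where "\<phi> = (\<lambda>j::int. \<lambda>p\<in>E. \<lambda>i. p (i + j))"
  have fin: "finite E" unfolding E_def using card_periodic(1)[OF assms] .
  show "finite (necklaces A l m k)" using fin by (simp add: necklaces_def E_def)
  let ?M = "integer_mod_group m"
  have carr: "carrier ?M = {0..<int m}" using assms by (simp add: carrier_integer_mod_group)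
  have tr: "(\<lambda>i. p (i + j)) \<in> E" if "p \<in> E" for p j
    using that periodic_translate weight_translate by (auto simp: E_def)
  have md: "p (i + j mod int m) = p (i + j)" if "p \<in> E" for p i j
    using periodic_mod[of "\<lambda>j. p (i + j)" m j] that by (simp add: E_def periodic_def add.assoc[symmetric])
  have bij: "\<phi> j \<in> carrier (BijGroup E)" for j
  proof -
    have "bij_betw (\<phi> j) E E"
      by (rule bij_betw_byWitness[where f' = "\<phi> (-j)"]) (use tr tr[of _ "-j"] in \<open>auto simp: \<phi>_def\<close>)
    then show ?thesis by (simp add: BijGroup_def Bij_def \<phi>_def)
  qed
  have act: "group_action ?M E \<phi>"
    unfolding group_action_def group_hom_def group_hom_axioms_def
  proof (intro conjI homI)
    show "group ?M" by simp
    show "group (BijGroup E)" by (rule group_BijGroup)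
    show "\<phi> j \<in> carrier (BijGroup E)" for j by (rule bij)
    fix i j assume "i \<in> carrier ?M" "j \<in> carrier ?M"
    have "\<phi> ((i + j) mod int m) = compose E (\<phi> i) (\<phi> j)"
      using tr by (auto simp: \<phi>_def compose_def fun_eq_iff md add.assoc)
    then show "\<phi> (i \<otimes>\<^bsub>?M\<^esub> j) = \<phi> i \<otimes>\<^bsub>BijGroup E\<^esub> \<phi> j"
      using bij by (simp add: BijGroup_def)
  qed
  have orbit: "orbit ?M \<phi> p = translates p" if p: "p \<in> E" for p
  proof -
    have "translates p \<subseteq> orbit ?M \<phi> p"
      unfolding translates_def orbit_def carr using md[OF p] assms p
      by (auto simp: \<phi>_def) (metis Euclidean_Rings.pos_mod_bound Euclidean_Rings.pos_mod_sign of_nat_0_less_iff)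
    then show ?thesis using p unfolding translates_def orbit_def by (auto simp: \<phi>_def)
  qed
  have "orbits ?M E \<phi> = necklaces A l m k"
    unfolding orbits_def necklaces_def using orbit by (auto simp: E_def)
  moreover have "(\<Sum>j\<in>{0..<int m}. card (invariants E \<phi> j)) = (\<Sum>j<m. card (invariants E \<phi> (int j)))"
    by (rule sum.reindex_bij_witness[of _ int nat]) auto
  moreover have "invariants E \<phi> (int j) = {p \<in> periodic A (gcd j m). weight l m p = k}" for j
    using periodic_gcd[of A m j] unfolding invariants_def E_def \<phi>_def by auto
  ultimately show "card (necklaces A l m k) * m = (\<Sum>j<m. card {p \<in> periodic A (gcd j m). weight l m p = k})"
    using group_action.burnside[OF act _ fin] assms by (simp add: carr Coset.order_def)
qed

text \<open>The rotation by j has gcd j m = m / r for totient r values of j, so r is the order of the rotation.\<close>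

lemma card_necklaces:
  assumes "m > 0"
  shows "real (card (necklaces A l m k)) =
    (\<Sum>r | r dvd m. real (totient r) / real m * fps_nth ((weight_series A l oo fps_X ^ r) ^ (m div r)) k)"
proof -
  let ?c = "\<lambda>d. real (card {p \<in> periodic A d. weight l m p = k})"
  have "real (card (necklaces A l m k)) * real m = (\<Sum>j<m. ?c (gcd j m))"
    using burnside_necklaces(2)[OF assms, of k] by (metis (no_types, lifting) of_nat_mult of_nat_sum sum.cong)
  also have "\<dots> = (\<Sum>j\<in>{0<..m}. ?c (gcd j m))"
    by (rule sum.reindex_bij_witness[of _ "\<lambda>j. if j = m then 0 else j" "\<lambda>j. if j = 0 then m else j"])
      (use assms in auto)
  also have "\<dots> = (\<Sum>d | d dvd m. \<Sum>j\<in>{j\<in>{0<..m}. gcd j m = d}. ?c (gcd j m))"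
    by (rule sum.group[symmetric]) (use assms in auto)
  also have "\<dots> = (\<Sum>d | d dvd m. real (totient (m div d)) * ?c d)"
    by (rule sum.cong) (use assms in \<open>auto simp flip: card_gcd_eq_totient\<close>)
  also have "\<dots> = (\<Sum>r | r dvd m. real (totient r) * ?c (m div r))"
    by (rule sum.reindex_bij_witness[of _ "\<lambda>r. m div r" "\<lambda>r. m div r"]) (use assms in auto)
  also have "\<dots> = (\<Sum>r | r dvd m. real (totient r) * fps_nth ((weight_series A l oo fps_X ^ r) ^ (m div r)) k)"
  proof (rule sum.cong)
    fix r assume "r \<in> {r. r dvd m}"
    then have "r > 0" "m div r > 0" "r * (m div r) = m" using assms by auto
    then show "real (totient r) * ?c (m div r) =
        real (totient r) * fps_nth ((weight_series A l oo fps_X ^ r) ^ (m div r)) k"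
      using card_fixed[of r "m div r" k] by simp
  qed simp
  finally show ?thesis using assms by (simp add: field_simps sum_divide_distrib[symmetric])
qed

text \<open>An orbit of the cyclic group of order m has at least 1 and at most m elements; the second bound
  is the summand j = 0 in Burnside's lemma.\<close>

lemma necklaces_bounds:
  assumes "m > 0"
  shows "real (card (necklaces A l m k)) \<le> fps_nth (weight_series A l ^ m) k"
    "fps_nth (weight_series A l ^ m) k \<le> real m * real (card (necklaces A l m k))"
proof -
  let ?P = "{p \<in> periodic A m. weight l m p = k}"
  have "card (necklaces A l m k) \<le> card ?P"
    unfolding necklaces_def by (rule card_image_le) (rule card_periodic(1)[OF assms])
  then have "real (card (necklaces A l m k)) \<le> real (card ?P)" by (rule of_nat_mono)
  then show "real (card (necklaces A l m k)) \<le> fps_nth (weight_series A l ^ m) k"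
    by (simp only: card_periodic(2)[OF assms])
  have "card ?P \<le> (\<Sum>j<m. card {p \<in> periodic A (gcd j m). weight l m p = k})"
    using member_le_sum[of 0 "{..<m}" "\<lambda>j. card {p \<in> periodic A (gcd j m). weight l m p = k}"] assms by simp
  then have "card ?P \<le> card (necklaces A l m k) * m" using burnside_necklaces(2)[OF assms] by simp
  then have "real (card ?P) \<le> real (card (necklaces A l m k) * m)" by (rule of_nat_mono)
  then show "fps_nth (weight_series A l ^ m) k \<le> real m * real (card (necklaces A l m k))"
    by (simp only: card_periodic(2)[OF assms] of_nat_mult mult.commute)
qed

end

section \<open>Conjugacy classes that move the cursor\<close>

context word_group
begin

sublocale sphere: weighted_alphabet "carrier H" len
  by unfold_locales (rule finite_sphere)

interpretation W: word_group W V by (rule word_group_W)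

text \<open>The function Q collects the products \<eta> i \<eta>(i - m) \<eta>(i - 2 m) ... from i downwards. It is trivial far
  to the left; far to the right it is constant along each coset of the multiples of m, and p is
  the periodic function of these constants.\<close>

definition coset_product :: "nat \<Rightarrow> (int \<Rightarrow> 'a) \<Rightarrow> (int \<Rightarrow> 'a) \<Rightarrow> bool" where
  "coset_product m \<eta> p \<longleftrightarrow> p \<in> periodic (carrier H) m \<and>
     (\<exists>Q N. (\<forall>i. Q i \<in> carrier H) \<and> (\<forall>i. Q i = \<eta> i \<otimes> Q (i - int m)) \<and>
        (\<forall>i < - N. Q i = \<one>) \<and> (\<forall>i \<ge> N. Q i = p i))"

lemma coset_productE:
  assumes "coset_product m \<eta> p"
  obtains Q N where "\<And>i. Q i \<in> carrier H" "\<And>i. Q i = \<eta> i \<otimes> Q (i - int m)"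
    "\<And>i. i < - N \<Longrightarrow> Q i = \<one>" "\<And>i. i \<ge> N \<Longrightarrow> Q i = p i" "N \<ge> 0"
proof -
  obtain Q N where Q: "\<forall>i. Q i \<in> carrier H" "\<forall>i. Q i = \<eta> i \<otimes> Q (i - int m)"
        "\<forall>i < - N. Q i = \<one>" "\<forall>i \<ge> N. Q i = p i"
    using assms unfolding coset_product_def by blast
  show ?thesis
  proof (rule that[of Q "max N 0"])
    show "Q i = \<eta> i \<otimes> Q (i - int m)" for i using Q(2) by blast
  qed (use Q(1,3,4) in auto)
qed

text \<open>The recursion for Q, cut off below N so that it terminates; nothing changes if N lies to the left
  of the support of \<eta>.\<close>

function prefix_product :: "nat \<Rightarrow> (int \<Rightarrow> 'a) \<Rightarrow> int \<Rightarrow> int \<Rightarrow> 'a" where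
  "prefix_product m \<eta> N i =
     (if i < N \<or> m = 0 then \<one> else \<eta> i \<otimes> prefix_product m \<eta> N (i - int m))"
  by pat_completeness auto
termination by (relation "Wellfounded.measure (\<lambda>(m, \<eta>, N, i). nat (i - N + 1))") auto

declare prefix_product.simps [simp del]

lemma coset_product_exists:
  assumes "\<eta> \<in> lamps" "m > 0"
  shows "\<exists>p. coset_product m \<eta> p"
proof -
  obtain n where n: "\<And>i. i < - int n \<or> i > int n \<Longrightarrow> \<eta> i = \<one>" using bounded_support[OF assms(1)] by blast
  define Q where "Q = prefix_product m \<eta> (- int n)"
  have closed: "prefix_product m \<eta> N i \<in> carrier H" for N i
    using lamps_closed[OF assms(1)]
  proof (induction "nat (i - N + 1)" arbitrary: i rule: less_induct)
    case less
    then have "prefix_product m \<eta> N (i - int m) \<in> carrier H" if "\<not> i < N"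
      using assms(2) that by simp
    then show ?case using less.prems by (subst prefix_product.simps) simp
  qed
  have Q1: "Q i = \<one>" if "i < - int n" for i unfolding Q_def by (subst prefix_product.simps) (use that in simp)
  have rec: "Q i = \<eta> i \<otimes> Q (i - int m)" for i
  proof (cases "i < - int n")
    case True
    then show ?thesis using Q1[of i] Q1[of "i - int m"] n by simp
  next
    case False
    then show ?thesis unfolding Q_def using assms by (subst prefix_product.simps) simp
  qed
  have step: "Q i = Q (i - int m)" if "i > int n" for i
    using rec[of i] n[of i] that closed by (simp add: Q_def)
  define N where "N = int n + 1"
  define p where "p = (\<lambda>i. Q (N + (i - N) mod int m))"
  have "Q (N + int k) = p (N + int k)" for k
  proof (induction k rule: less_induct)
    case (less k)
    show ?case
    proof (cases "k < m")
      case True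
      then show ?thesis by (simp add: p_def)
    next
      case False
      then have "Q (N + int k) = Q (N + int (k - m))"
        using step[of "N + int k"] by (simp add: N_def of_nat_diff algebra_simps)
      also have "\<dots> = p (N + int (k - m))" using less[of "k - m"] False assms by simp
      also have "\<dots> = p (N + int k)" using False by (simp add: p_def of_nat_diff)
      finally show ?thesis .
    qed
  qed
  then have "Q i = p i" if "i \<ge> N" for i using that by (metis zle_iff_zadd)
  moreover have "p \<in> periodic (carrier H) m"
  proof -
    have "(i + int m - N) mod int m = (i - N) mod int m" for i
      by (metis add_diff_eq add.commute mod_add_self2 diff_add_eq)
    then show ?thesis unfolding periodic_def using closed by (auto simp: p_def Q_def)
  qed
  ultimately have "coset_product m \<eta> p"
    unfolding coset_product_def
  proof (intro conjI exI[of _ Q] exI[of _ N] allI impI)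
    show "Q i \<in> carrier H" for i unfolding Q_def by (rule closed)
    show "Q i = \<eta> i \<otimes> Q (i - int m)" for i by (rule rec)
    show "Q i = \<one>" if "i < - N" for i by (rule Q1) (use that in \<open>simp add: N_def\<close>)
  qed
  then show ?thesis by blast
qed

text \<open>Two prefix products of the same lamp configuration agree to the left of its support, hence
  everywhere.\<close>

lemma coset_product_unique:
  assumes "coset_product m \<eta> p" "coset_product m \<eta> q" "m > 0"
  shows "p = q"
proof -
  obtain P M where P: "\<And>i. P i \<in> carrier H" "\<And>i. P i = \<eta> i \<otimes> P (i - int m)"
    "\<And>i. i < - M \<Longrightarrow> P i = \<one>" "\<And>i. i \<ge> M \<Longrightarrow> P i = p i" using coset_productE[OF assms(1)] by metis
  obtain Q N where Q: "\<And>i. Q i \<in> carrier H" "\<And>i. Q i = \<eta> i \<otimes> Q (i - int m)"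
    "\<And>i. i < - N \<Longrightarrow> Q i = \<one>" "\<And>i. i \<ge> N \<Longrightarrow> Q i = q i" using coset_productE[OF assms(2)] by metis
  have per: "p (i + int m * k) = p i" "q (i + int m * k) = q i" for i k
    using assms(1,2) by (auto intro!: periodic_mult simp: coset_product_def periodic_def)
  define K where "K = max M N"
  have eq: "P i = Q i" for i
  proof (induction "nat (i + K)" arbitrary: i rule: less_induct)
    case less
    show ?case
    proof (cases "i < - K")
      case True
      then show ?thesis using P(3)[of i] Q(3)[of i] by (simp add: K_def)
    next
      case False
      then have "P (i - int m) = Q (i - int m)" 
        using P(3)[of "i - int m"] Q(3)[of "i - int m"] less[of "i - int m"] assms(3)
        by (cases "i - int m < - K") (auto simp: K_def)
      then show ?thesis using P(2)[of i] Q(2)[of i] by simp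
    qed
  qed
  have "p i = q i" for i
  proof -
    have "K \<le> i + int m * (\<bar>K\<bar> + \<bar>i\<bar>)"
    proof -
      have "1 * (\<bar>K\<bar> + \<bar>i\<bar>) \<le> int m * (\<bar>K\<bar> + \<bar>i\<bar>)" using assms(3) by (intro mult_right_mono) auto
      moreover have "K \<le> i + (\<bar>K\<bar> + \<bar>i\<bar>)" by linarith
      ultimately show ?thesis by simp
    qed
    then have "p (i + int m * (\<bar>K\<bar> + \<bar>i\<bar>)) = q (i + int m * (\<bar>K\<bar> + \<bar>i\<bar>))"
      using P(4) Q(4) eq by (metis K_def max.bounded_iff)
    then show ?thesis by (simp add: per)
  qed
  then show ?thesis by auto
qed

lemma coset_product_standard:
  assumes "p \<in> periodic (carrier H) m" "m > 0"
  shows "coset_product m (\<lambda>i. if 0 \<le> i \<and> i < int m then p i else \<one>) p"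
proof -
  have p: "p i \<in> carrier H" "p (i + int m) = p i" for i using assms by (auto simp: periodic_def)
  have "p (i - int m) = p i" for i using p(2)[of "i - int m"] by simp
  then show ?thesis
    unfolding coset_product_def using p assms
    by (intro conjI exI[of _ "\<lambda>i. if i < 0 then \<one> else p i"] exI[of _ 0]) auto
qed

text \<open>The finite support of the conjugating configuration makes its contributions at both ends
  of a coset trivial; this is why the product itself, and not only its conjugacy class, survives.\<close>

lemma coset_product_conj:
  assumes "coset_product m \<eta> p" "\<eta> \<in> lamps" "\<theta> \<in> lamps"
  shows "coset_product m (\<lambda>i. \<theta> i \<otimes> \<eta> (i - n) \<otimes> inv (\<theta> (i - int m))) (\<lambda>i. p (i - n))"
proof -
  obtain Q N where Q: "\<And>i. Q i \<in> carrier H" "\<And>i. Q i = \<eta> i \<otimes> Q (i - int m)"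
    "\<And>i. i < - N \<Longrightarrow> Q i = \<one>" "\<And>i. i \<ge> N \<Longrightarrow> Q i = p i" using coset_productE[OF assms(1)] by metis
  obtain k where k: "\<And>i. i < - int k \<or> i > int k \<Longrightarrow> \<theta> i = \<one>" using bounded_support[OF assms(3)] by blast
  have cl: "\<theta> i \<in> carrier H" "\<eta> i \<in> carrier H" for i using assms lamps_closed by auto
  have p: "p \<in> periodic (carrier H) m" using assms(1) by (simp add: coset_product_def)
  define M where "M = \<bar>N\<bar> + \<bar>n\<bar> + int k + 1"
  have rec: "\<theta> i \<otimes> Q (i - n) = (\<theta> i \<otimes> \<eta> (i - n) \<otimes> inv (\<theta> (i - int m))) \<otimes> (\<theta> (i - int m) \<otimes> Q (i - int m - n))" for i
  proof -
    have "(\<theta> i \<otimes> \<eta> (i - n) \<otimes> inv (\<theta> (i - int m))) \<otimes> (\<theta> (i - int m) \<otimes> Q (i - int m - n))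
      = \<theta> i \<otimes> (\<eta> (i - n) \<otimes> ((inv (\<theta> (i - int m)) \<otimes> \<theta> (i - int m)) \<otimes> Q (i - int m - n)))"
      using cl Q(1) by (simp only: m_assoc inv_closed m_closed)
    also have "\<dots> = \<theta> i \<otimes> Q (i - n)" using cl Q(1) Q(2)[of "i - n"] by (simp add: algebra_simps)
    finally show ?thesis ..
  qed
  show ?thesis
    unfolding coset_product_def
  proof (intro conjI exI[of _ "\<lambda>i. \<theta> i \<otimes> Q (i - n)"] exI[of _ M] allI impI)
    show "(\<lambda>i. p (i - n)) \<in> periodic (carrier H) m"
      using periodic_translate[OF p, of "- n"] by simp
    show "\<theta> i \<otimes> Q (i - n) \<in> carrier H" for i using cl Q(1) by simp
    show "\<theta> i \<otimes> Q (i - n) = \<one>" if "i < - M" for i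
    proof -
      have "i < - int k" "i - n < - N" using that unfolding M_def by linarith+
      then show ?thesis using k[of i] Q(3)[of "i - n"] by simp
    qed
    show "\<theta> i \<otimes> Q (i - n) = p (i - n)" if "i \<ge> M" for i
    proof -
      have "i > int k" "i - n \<ge> N" using that unfolding M_def by linarith+
      then show ?thesis using k[of i] Q(4)[of "i - n"] Q(1)[of "i - n"] by simp
    qed
  qed (rule rec)
qed

lemma coset_product_shift:
  assumes "coset_product m \<eta> p" "\<eta> \<in> lamps"
  shows "coset_product m (\<lambda>i. \<eta> (i - n)) (\<lambda>i. p (i - n))"
  using coset_product_conj[OF assms lamps_one, of n] lamps_closed[OF assms(2)] by simp

text \<open>The ratio of the two prefix products has finite support, and it conjugates one
  configuration into the other.\<close>

lemma coset_product_eq_imp_conj: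
  assumes "coset_product m \<eta> p" "coset_product m \<theta> p" "\<eta> \<in> lamps" "\<theta> \<in> lamps"
  shows "(\<theta>, int m) \<in> W.conj_class (\<eta>, int m)"
proof -
  obtain P M where P: "\<And>i. P i \<in> carrier H" "\<And>i. P i = \<eta> i \<otimes> P (i - int m)"
    "\<And>i. i < - M \<Longrightarrow> P i = \<one>" "\<And>i. i \<ge> M \<Longrightarrow> P i = p i" using coset_productE[OF assms(1)] by metis
  obtain Q N where Q: "\<And>i. Q i \<in> carrier H" "\<And>i. Q i = \<theta> i \<otimes> Q (i - int m)"
    "\<And>i. i < - N \<Longrightarrow> Q i = \<one>" "\<And>i. i \<ge> N \<Longrightarrow> Q i = p i" using coset_productE[OF assms(2)] by metis
  have cl: "\<theta> i \<in> carrier H" "\<eta> i \<in> carrier H" for i using assms lamps_closed by auto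
  define \<zeta> where "\<zeta> = (\<lambda>i. Q i \<otimes> inv (P i))"
  have "\<zeta> i = \<one>" if "i \<notin> {- max M N..max M N}" for i
  proof -
    have "i < - max M N \<or> i > max M N" using that by auto
    then show ?thesis using P(1,3,4)[of i] Q(3,4)[of i] by (auto simp: \<zeta>_def)
  qed
  then have \<zeta>: "\<zeta> \<in> lamps"
    by (intro lampsI[of _ "{- max M N..max M N}"]) (auto simp: \<zeta>_def P(1) Q(1))
  have "\<theta> i = \<zeta> i \<otimes> \<eta> i \<otimes> inv (\<zeta> (i - int m))" for i
  proof -
    have "\<zeta> i \<otimes> \<eta> i \<otimes> inv (\<zeta> (i - int m)) =
       Q i \<otimes> (inv (P i) \<otimes> (\<eta> i \<otimes> P (i - int m))) \<otimes> inv (Q (i - int m))"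
      using P(1) Q(1) cl by (simp add: \<zeta>_def inv_mult_group m_assoc)
    also have "\<dots> = Q i \<otimes> inv (Q (i - int m))" using P(1) Q(1) by (simp flip: P(2))
    also have "\<dots> = \<theta> i" using Q(1) cl by (subst Q(2)) (simp add: m_assoc)
    finally show ?thesis ..
  qed
  then show ?thesis
    unfolding conj_class_W[OF assms(3)]
    by (intro CollectI exI[of _ \<zeta>] exI[of _ 0]) (use \<zeta> in auto)
qed

text \<open>The necklace of the coset products is a complete conjugacy invariant.\<close>

lemma conj_class_W_iff:
  assumes "coset_product m \<eta> p" "coset_product m \<theta> q" "\<eta> \<in> lamps" "\<theta> \<in> lamps" "m > 0"
  shows "W.conj_class (\<theta>, int m) = W.conj_class (\<eta>, int m) \<longleftrightarrow> q \<in> translates p"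
proof
  assume "W.conj_class (\<theta>, int m) = W.conj_class (\<eta>, int m)"
  then have "(\<theta>, int m) \<in> W.conj_class (\<eta>, int m)"
    using W.conj_class_refl[of "(\<theta>, int m)"] assms by (simp add: carrier_W)
  then obtain \<zeta> n where "\<zeta> \<in> lamps" "\<theta> = (\<lambda>i. \<zeta> i \<otimes> \<eta> (i - n) \<otimes> inv (\<zeta> (i - int m)))"
    unfolding conj_class_W[OF assms(3)] by blast
  then have "coset_product m \<theta> (\<lambda>i. p (i - n))" using coset_product_conj assms by blast
  then have "q = (\<lambda>i. p (i - n))" using coset_product_unique assms by blast
  then show "q \<in> translates p" unfolding translates_def by (intro CollectI exI[of _ "- n"]) auto
next
  assume "q \<in> translates p"
  then obtain j where q: "q = (\<lambda>i. p (i - (- j)))" by (auto simp: translates_def)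
  define \<eta>' where "\<eta>' = (\<lambda>i. \<eta> (i - (- j)))"
  have \<eta>': "\<eta>' \<in> lamps" unfolding \<eta>'_def using lamps_shift assms by blast
  have "coset_product m \<eta>' q" unfolding \<eta>'_def q by (rule coset_product_shift) (use assms in auto)
  then have "(\<theta>, int m) \<in> W.conj_class (\<eta>', int m)" using coset_product_eq_imp_conj assms \<eta>' by blast
  moreover have "(\<eta>', int m) \<in> W.conj_class (\<eta>, int m)"
    unfolding conj_class_W[OF assms(3)] \<eta>'_def
    by (intro CollectI exI[of _ "\<lambda>i. \<one>"] exI[of _ "- j"]) (auto simp: lamps_one lamps_closed[OF assms(3)])
  ultimately show "W.conj_class (\<theta>, int m) = W.conj_class (\<eta>, int m)"
    using W.conj_class_eq assms \<eta>' by (metis SigmaI UNIV_I carrier_W)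
qed

lemma sum_le_lamp_len:
  assumes "\<eta> \<in> lamps" "finite I" shows "(\<Sum>i\<in>I. len (\<eta> i)) \<le> lamp_len \<eta>"
proof -
  have "lamp_len \<eta> = (\<Sum>i\<in>I \<union> {i. \<eta> i \<noteq> \<one>}. len (\<eta> i))"
    by (rule lamp_len_eq) (use assms lamps_finite in auto)
  then show ?thesis using assms lamps_finite by (auto intro!: sum_mono2)
qed

text \<open>Sliding a window of m consecutive prefix products to the right past position i replaces
  the entry Q (i - m) by \<eta> i Q (i - m), so the total length in the window grows by at most the
  length of \<eta> i.\<close>

lemma weight_coset_product_le:
  assumes "coset_product m \<eta> p" "\<eta> \<in> lamps"
  shows "weight len m p \<le> lamp_len \<eta>"
proof (cases m)
  case 0
  then show ?thesis by (simp add: weight_def)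
next
  case (Suc m')
  obtain Q N where Q: "\<And>i. Q i \<in> carrier H" "\<And>i. Q i = \<eta> i \<otimes> Q (i - int m)"
    "\<And>i. i < - N \<Longrightarrow> Q i = \<one>" "\<And>i. i \<ge> N \<Longrightarrow> Q i = p i" "N \<ge> 0" using coset_productE[OF assms(1)] by metis
  have p: "p \<in> periodic (carrier H) m" using assms(1) by (simp add: coset_product_def)
  \<comment> \<open>at j = - N - 1 the window only contains trivial prefix products\<close>
  have slide: "(\<Sum>i<m. len (Q (j - int i))) \<le> (\<Sum>i\<in>{- N..j}. len (\<eta> i))" if "j \<ge> - N - 1" for j
    using that
  proof (induction j rule: int_ge_induct)
    case base
    have "(\<Sum>i<m. len (Q (- N - 1 - int i))) = (\<Sum>i<m. 0)" by (rule sum.cong) (use Q(3) in auto)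
    then show ?case by simp
  next
    case (step j)
    have "(\<Sum>i<m. len (Q (j + 1 - int i))) = len (Q (j + 1)) + (\<Sum>i<m'. len (Q (j - int i)))"
      unfolding Suc by (subst sum.lessThan_Suc_shift) simp
    also have "len (Q (j + 1)) \<le> len (\<eta> (j + 1)) + len (Q (j - int m'))"
      using len_mult_le[of "\<eta> (j + 1)" "Q (j - int m')"] Q(1) Q(2)[of "j + 1"] lamps_closed[OF assms(2)] Suc
      by simp
    also have "len (\<eta> (j + 1)) + len (Q (j - int m')) + (\<Sum>i<m'. len (Q (j - int i))) =
        len (\<eta> (j + 1)) + (\<Sum>i<m. len (Q (j - int i)))" unfolding Suc by simp
    also have "\<dots> \<le> len (\<eta> (j + 1)) + (\<Sum>i\<in>{- N..j}. len (\<eta> i))" using step by simp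
    also have "\<dots> = (\<Sum>i\<in>{- N..j + 1}. len (\<eta> i))"
    proof -
      have "{- N..j + 1} = insert (j + 1) {- N..j}" using step by auto
      then show ?thesis by simp
    qed
    finally show ?case by simp
  qed
  define j where "j = N + int m"
  have "weight len m p = weight len m (\<lambda>i. p (i + (N + 1)))" using weight_translate[OF p] by metis
  also have "\<dots> = (\<Sum>i<m. len (p (int (m - Suc i) + (N + 1))))"
    unfolding weight_def by (rule sum.nat_diff_reindex[symmetric])
  also have "\<dots> = (\<Sum>i<m. len (Q (j - int i)))"
    by (rule sum.cong) (use Q(4) in \<open>auto simp: j_def of_nat_diff algebra_simps\<close>)
  also have "\<dots> \<le> (\<Sum>i\<in>{- N..j}. len (\<eta> i))" by (rule slide) (use Q(5) in \<open>simp add: j_def\<close>)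
  also have "\<dots> \<le> lamp_len \<eta>" using assms sum_le_lamp_len by simp
  finally show ?thesis .
qed

text \<open>The minimum is attained by the configuration that carries p on 0, ..., m - 1: a word for it sets
  each lamp while the cursor passes from 0 to m.\<close>

lemma class_length_moving:
  assumes "coset_product m \<eta> p" "\<eta> \<in> lamps" "m > 0"
  shows "class_length W V (W.conj_class (\<eta>, int m)) = m + weight len m p"
proof -
  define \<theta> where "\<theta> = (\<lambda>i. if 0 \<le> i \<and> i < int m then p i else \<one>)"
  have p: "p \<in> periodic (carrier H) m" using assms(1) by (simp add: coset_product_def)
  have \<theta>: "\<theta> \<in> lamps" using p by (intro lampsI[of _ "{0..<int m}"]) (auto simp: \<theta>_def periodic_def)
  have \<theta>p: "coset_product m \<theta> p" unfolding \<theta>_def by (rule coset_product_standard[OF p assms(3)])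
  show ?thesis
  proof (rule W.class_length_eqI)
    show "W.conj_class (\<eta>, int m) \<in> conj_classes W" using W.conj_class_in assms by (simp add: carrier_W)
    show "(\<theta>, int m) \<in> W.conj_class (\<eta>, int m)" by (rule coset_product_eq_imp_conj) fact+
    have "reach (m + (\<Sum>i\<le>m. len (\<theta> (int i)))) (\<theta>, int m)"
      by (rule reach_strip[OF \<theta>]) (auto simp: \<theta>_def)
    moreover have "(\<Sum>i\<le>m. len (\<theta> (int i))) = weight len m p"
      unfolding weight_def by (simp add: lessThan_Suc_atMost[symmetric] \<theta>_def)
    ultimately show "word_length W V (\<theta>, int m) \<le> m + weight len m p" using len_W_le_reach by simp
  next
    fix g assume "g \<in> W.conj_class (\<eta>, int m)"
    then obtain \<zeta> n where \<zeta>: "\<zeta> \<in> lamps" "g = (\<lambda>i. \<zeta> i \<otimes> \<eta> (i - n) \<otimes> inv (\<zeta> (i - int m)), int m)"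
      unfolding conj_class_W[OF assms(2)] by blast
    define \<eta>' where "\<eta>' = (\<lambda>i. \<zeta> i \<otimes> \<eta> (i - n) \<otimes> inv (\<zeta> (i - int m)))"
    have "g \<in> carrier W" using W.conj_class_closed \<open>g \<in> _\<close> assms(2) by (fastforce simp: carrier_W)
    then have \<eta>': "\<eta>' \<in> lamps" using \<zeta>(2) by (simp add: carrier_W \<eta>'_def)
    have "weight len m p = weight len m (\<lambda>i. p (i - n))" using weight_translate[OF p, of len "- n"] by simp
    also have "\<dots> \<le> lamp_len \<eta>'"
      by (rule weight_coset_product_le[OF _ \<eta>']) (use coset_product_conj assms \<zeta> \<eta>'_def in blast)
    finally have le: "weight len m p \<le> lamp_len \<eta>'" .
    show "m + weight len m p \<le> word_length W V g"
      using len_W_ge_cursor[OF \<eta>', of "int m"] le \<zeta>(2) unfolding \<eta>'_def[symmetric] by simp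
  qed
qed

text \<open>All members of a class have the same cursor position.\<close>

definition classes_at :: "int \<Rightarrow> nat \<Rightarrow> ((int \<Rightarrow> 'a) \<times> int) set set" where
  "classes_at m n = {C \<in> conj_classes W. class_length W V C = n \<and> snd ` C = {m}}"

lemma snd_conj_class_W: "\<eta> \<in> lamps \<Longrightarrow> snd ` W.conj_class (\<eta>, m) = {m}"
  using lamps_one by (subst conj_class_W) force+

lemma classes_atE:
  assumes "C \<in> classes_at m n"
  obtains \<eta> where "\<eta> \<in> lamps" "C = W.conj_class (\<eta>, m)"
proof -
  have C: "C \<in> conj_classes W" "snd ` C = {m}" using assms by (auto simp: classes_at_def)
  then obtain \<eta> k where "\<eta> \<in> lamps" "C = W.conj_class (\<eta>, k)"
    unfolding W.conj_classes_eq by (auto simp: carrier_W)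
  then show ?thesis using that C(2) snd_conj_class_W by (metis singleton_inject)
qed

text \<open>A class is matched with the necklace of the coset products of its members.\<close>

lemma card_classes_moving:
  assumes "m > 0" "m \<le> n"
  shows "card (classes_at (int m) n) = card (necklaces (carrier H) len m (n - m))"
proof -
  define F where "F = (\<lambda>C. {p. \<exists>\<eta>. (\<eta>, int m) \<in> C \<and> coset_product m \<eta> p})"
  have F: "F (W.conj_class (\<eta>, int m)) = translates p" if "coset_product m \<eta> p" "\<eta> \<in> lamps" for \<eta> p
  proof (intro equalityI subsetI)
    fix q assume "q \<in> F (W.conj_class (\<eta>, int m))"
    then obtain \<theta> where \<theta>: "(\<theta>, int m) \<in> W.conj_class (\<eta>, int m)" "coset_product m \<theta> q"
      by (auto simp: F_def)
    have c: "(\<eta>, int m) \<in> carrier W" using that by (simp add: carrier_W)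
    then have "\<theta> \<in> lamps" using W.conj_class_closed[OF c] \<theta>(1) by (auto simp: carrier_W)
    then show "q \<in> translates p"
      using conj_class_W_iff[OF that(1) \<theta>(2) that(2) _ assms(1)] W.conj_class_eq[OF c \<theta>(1)] by simp
  next
    fix q assume "q \<in> translates p"
    then obtain j where q: "q = (\<lambda>i. p (i - (- j)))" by (auto simp: translates_def)
    have "(\<lambda>i. \<eta> (i - (- j)), int m) \<in> W.conj_class (\<eta>, int m)"
      unfolding conj_class_W[OF that(2)]
      by (intro CollectI exI[of _ "\<lambda>i. \<one>"] exI[of _ "- j"]) (auto simp: lamps_one lamps_closed[OF that(2)])
    then show "q \<in> F (W.conj_class (\<eta>, int m))"
      unfolding F_def q using coset_product_shift[OF that] by blast
  qed
  have "bij_betw F (classes_at (int m) n) (necklaces (carrier H) len m (n - m))"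
  proof (rule bij_betwI')
    fix C D assume "C \<in> classes_at (int m) n" "D \<in> classes_at (int m) n"
    then obtain \<eta> \<theta> where e: "\<eta> \<in> lamps" "C = W.conj_class (\<eta>, int m)" "\<theta> \<in> lamps" "D = W.conj_class (\<theta>, int m)"
      by (metis classes_atE)
    obtain p q where pq: "coset_product m \<eta> p" "coset_product m \<theta> q"
      using coset_product_exists e assms by metis
    have "F C = F D \<Longrightarrow> C = D"
      using F[OF pq(1) e(1)] F[OF pq(2) e(3)] conj_class_W_iff[OF pq e(1,3) assms(1)] translates_refl[of q] e
      by simp
    then show "F C = F D \<longleftrightarrow> C = D" by blast
  next
    fix C assume C: "C \<in> classes_at (int m) n"
    then obtain \<eta> where e: "\<eta> \<in> lamps" "C = W.conj_class (\<eta>, int m)" by (metis classes_atE)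
    obtain p where p: "coset_product m \<eta> p" using coset_product_exists e assms by metis
    have "m + weight len m p = n" using class_length_moving[OF p e(1) assms(1)] C e by (simp add: classes_at_def)
    moreover have "p \<in> periodic (carrier H) m" using p by (simp add: coset_product_def)
    ultimately show "F C \<in> necklaces (carrier H) len m (n - m)"
      unfolding e(2) F[OF p e(1)] necklaces_def by auto
  next
    fix O' assume "O' \<in> necklaces (carrier H) len m (n - m)"
    then obtain p where p: "p \<in> periodic (carrier H) m" "weight len m p = n - m" "O' = translates p"
      by (auto simp: necklaces_def)
    define \<theta> where "\<theta> = (\<lambda>i. if 0 \<le> i \<and> i < int m then p i else \<one>)"
    have \<theta>: "\<theta> \<in> lamps" using p by (intro lampsI[of _ "{0..<int m}"]) (auto simp: \<theta>_def periodic_def)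
    have \<theta>p: "coset_product m \<theta> p" unfolding \<theta>_def by (rule coset_product_standard[OF p(1) assms(1)])
    have "W.conj_class (\<theta>, int m) \<in> classes_at (int m) n"
      using class_length_moving[OF \<theta>p \<theta> assms(1)] p assms W.conj_class_in[of "(\<theta>, int m)"] \<theta> snd_conj_class_W[OF \<theta>]
      by (simp add: classes_at_def carrier_W)
    then show "\<exists>C\<in>classes_at (int m) n. O' = F C" using F[OF \<theta>p \<theta>] p(3) by auto
  qed
  then show ?thesis by (rule bij_betw_same_card)
qed

lemma card_classes_moving_neg: "card (classes_at (- m) n) = card (classes_at m n)"
proof -
  have sub: "m_inv W ` C \<in> classes_at (- m) n" if cls: "C \<in> classes_at m n" for m C
  proof -
    have C: "C \<in> conj_classes W" "class_length W V C = n" "snd ` C = {m}"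
      using cls by (auto simp: classes_at_def)
    have "snd (m_inv W x) = - snd x" if "x \<in> C" for x
      using W.conj_class_memD(1)[OF C(1) that] inv_W by (cases x) (auto simp: carrier_W)
    then have "snd ` m_inv W ` C = uminus ` snd ` C" by (simp add: image_image)
    then show ?thesis using W.inv_class[OF C(1)] C by (simp add: classes_at_def)
  qed
  have "bij_betw ((`) (m_inv W)) (classes_at m n) (classes_at (- m) n)"
  proof (rule bij_betw_byWitness[where f' = "(`) (m_inv W)"])
    show "(`) (m_inv W) ` classes_at m n \<subseteq> classes_at (- m) n" using sub by blast
    show "(`) (m_inv W) ` classes_at (- m) n \<subseteq> classes_at m n" using sub[of _ "- m"] by auto
  qed (use W.inv_inv_class in \<open>auto simp: classes_at_def\<close>)
  then show ?thesis using bij_betw_same_card by fastforce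
qed

text \<open>The cursor needs \<bar>m\<bar> moves to reach m.\<close>

lemma classes_at_eq_empty:
  assumes "\<bar>m\<bar> > int n" shows "classes_at m n = {}"
proof (rule ccontr)
  assume "classes_at m n \<noteq> {}"
  then obtain C where C: "C \<in> classes_at m n" by auto
  then have CC: "C \<in> conj_classes W" "class_length W V C = n" "snd ` C = {m}" by (auto simp: classes_at_def)
  obtain h where h: "h \<in> C" "W.len h = n" using W.class_length_attained[OF CC(1)] CC(2) by metis
  have "snd h = m" using CC(3) h(1) by auto
  moreover have "h \<in> carrier W" using W.conj_class_memD(1)[OF CC(1) h(1)] .
  ultimately have h': "h = (fst h, m)" "fst h \<in> lamps" by (auto simp: carrier_W)
  show False using len_W_ge_cursor[OF h'(2), of m] assms h(2) h'(1) by auto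
qed

lemma card_classes_W:
  "card {C \<in> conj_classes W. class_length W V C = n} =
     card (classes_at 0 n) + 2 * (\<Sum>m=1..n. card (necklaces (carrier H) len m (n - m)))"
proof -
  let ?C = "\<lambda>m. classes_at m n"
  have fin: "finite (?C m)" for m
    by (rule finite_subset[OF _ W.finite_classes_of_length[of n]]) (auto simp: classes_at_def)
  have "{C \<in> conj_classes W. class_length W V C = n} = (\<Union>m\<in>{- int n..int n}. ?C m)"
  proof (intro equalityI subsetI)
    fix C assume C: "C \<in> {C \<in> conj_classes W. class_length W V C = n}"
    then obtain \<eta> k where "\<eta> \<in> lamps" "C = W.conj_class (\<eta>, k)"
      unfolding W.conj_classes_eq by (auto simp: carrier_W)
    then have "C \<in> ?C k" using C snd_conj_class_W by (simp add: classes_at_def)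
    moreover from this have "\<bar>k\<bar> \<le> int n" using classes_at_eq_empty[of n k] by fastforce
    ultimately show "C \<in> (\<Union>m\<in>{- int n..int n}. ?C m)" by (auto intro!: bexI[of _ k])
  qed (auto simp: classes_at_def)
  moreover have "card (\<Union>m\<in>{- int n..int n}. ?C m) = (\<Sum>m\<in>{- int n..int n}. card (?C m))"
    by (rule card_UN_disjoint) (use fin in \<open>auto simp: classes_at_def\<close>)
  moreover have "(\<Sum>m\<in>{- int n..int n}. card (?C m)) =
      card (?C 0) + (\<Sum>m\<in>{1..int n}. card (?C m)) + (\<Sum>m\<in>{- int n..-1}. card (?C m))"
  proof -
    have "{- int n..int n} = insert 0 ({1..int n} \<union> {- int n..-1})" by auto
    then show ?thesis by (simp add: sum.union_disjoint)
  qed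
  moreover have "(\<Sum>m\<in>{- int n..-1}. card (?C m)) = (\<Sum>m\<in>{1..int n}. card (?C m))"
    by (rule sum.reindex_bij_witness[of _ uminus uminus]) (auto simp: card_classes_moving_neg)
  moreover have "(\<Sum>m\<in>{1..int n}. card (?C m)) = (\<Sum>m=1..n. card (necklaces (carrier H) len m (n - m)))"
    by (rule sum.reindex_bij_witness[of _ int nat]) (auto simp: card_classes_moving[symmetric])
  ultimately show ?thesis by simp
qed

end

section \<open>Conjugacy classes that fix the cursor\<close>

text \<open>The geometric series may be truncated, as b^v does not affect coefficients below v.\<close>

lemma fps_divide_one_minus_nth:
  fixes a b :: "'a :: field fps"
  assumes "fps_nth b 0 = 0"
  shows "fps_nth (a / (1 - b)) n = fps_nth (a * (\<Sum>v\<le>n. b ^ v)) n"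
proof -
  define i where "i = inverse (1 - b)"
  have i: "(1 - b) * i = 1" unfolding i_def using assms by (intro inverse_mult_eq_1') simp
  have "(\<Sum>v\<le>n. b ^ v) = (\<Sum>v\<le>n. b ^ v) * ((1 - b) * i)" by (simp add: i)
  also have "\<dots> = (1 - b ^ Suc n) * i"
    by (simp only: mult.assoc[symmetric] mult.commute[of _ "1 - b"] sum_gp_basic)
  finally have S: "(\<Sum>v\<le>n. b ^ v) = (1 - b ^ Suc n) * i" .
  have "a * (\<Sum>v\<le>n. b ^ v) = a * i - b ^ Suc n * (a * i)" unfolding S by (simp add: algebra_simps)
  moreover have "fps_nth (b ^ Suc n * (a * i)) n = 0"
  proof (subst fps_mult_nth, intro sum.neutral ballI)
    fix k assume "k \<in> {0..n}"
    then have "fps_nth (b ^ Suc n) k = 0" using startsby_zero_power_prefix[OF assms, of "Suc n"] by simp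
    then show "fps_nth (b ^ Suc n) k * fps_nth (a * i) (n - k) = 0" by simp
  qed
  moreover have "a / (1 - b) = a * i" unfolding i_def using assms by (intro fps_divide_unit) simp
  ultimately show ?thesis by simp
qed

context word_group
begin

interpretation W: word_group W V by (rule word_group_W)

abbreviation clen :: "'a set \<Rightarrow> nat" where "clen \<equiv> class_length H Z"

text \<open>A pattern of conjugacy classes is normalised by translation: the leftmost point of its support is 0,
  and w is the rightmost. The trivial pattern has no such normal form and is treated apart.\<close>

definition strip :: "nat \<Rightarrow> (int \<Rightarrow> 'a set) set" where
  "strip w = {\<kappa>. (\<forall>i. \<kappa> i \<in> conj_classes H) \<and> \<kappa> 0 \<noteq> {\<one>} \<and> \<kappa> (int w) \<noteq> {\<one>} \<and>
     (\<forall>i. i < 0 \<or> i > int w \<longrightarrow> \<kappa> i = {\<one>})}"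

definition strip_len :: "nat \<Rightarrow> (int \<Rightarrow> 'a set) \<Rightarrow> nat" where
  "strip_len w \<kappa> = 2 * w + (\<Sum>i\<in>{0..int w}. clen (\<kappa> i))"

definition pattern_class :: "(int \<Rightarrow> 'a set) \<Rightarrow> ((int \<Rightarrow> 'a) \<times> int) set" where
  "pattern_class \<kappa> = {(\<eta>, 0) | \<eta>. \<exists>j. \<forall>i. \<eta> i \<in> \<kappa> (i - j)}"

lemma strip_trivial: "\<kappa> \<in> strip w \<Longrightarrow> \<one> \<in> \<kappa> i \<Longrightarrow> \<kappa> i = {\<one>}"
  unfolding strip_def using conj_class_with_one by blast

lemma strip_rep_lamps:
  assumes "\<kappa> \<in> strip w" "\<And>i. \<eta> i \<in> \<kappa> (i - j)"
  shows "\<eta> \<in> lamps"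
proof (rule lampsI)
  show "\<eta> i \<in> carrier H" for i using assms conj_class_memD(1) unfolding strip_def by blast
  show "finite {j..j + int w}" by simp
  show "\<eta> i = \<one>" if "i \<notin> {j..j + int w}" for i
    using assms(2)[of i] assms(1) that by (auto simp: strip_def)
qed

text \<open>Two configurations with lamps in the same classes are conjugate position by position. Where the class is
  trivial the conjugating lamp is chosen trivial too, which keeps its support finite.\<close>

lemma pattern_class_eq:
  assumes "\<kappa> \<in> strip w" "\<And>i. \<eta> i \<in> \<kappa> i"
  shows "pattern_class \<kappa> = W.conj_class (\<eta>, 0)"
proof -
  have \<eta>: "\<eta> \<in> lamps" using strip_rep_lamps[of \<kappa> w \<eta> 0] assms by simp
  have \<kappa>: "\<kappa> i = conj_class (\<eta> i)" for i
    using assms conj_class_memD(2) unfolding strip_def by blast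
  show ?thesis
  proof (intro equalityI subsetI)
    fix h assume "h \<in> pattern_class \<kappa>"
    then obtain \<eta>' j where h: "h = (\<eta>', 0)" "\<And>i. \<eta>' i \<in> \<kappa> (i - j)" by (auto simp: pattern_class_def)
    then have "\<exists>x. x \<in> carrier H \<and> \<eta>' i = x \<otimes> \<eta> (i - j) \<otimes> inv x" for i
      unfolding \<kappa> conj_class_def by blast
    then obtain \<theta> where \<theta>: "\<And>i. \<theta> i \<in> carrier H" "\<And>i. \<eta>' i = \<theta> i \<otimes> \<eta> (i - j) \<otimes> inv (\<theta> i)" by metis
    define \<zeta> where "\<zeta> = (\<lambda>i. if \<kappa> (i - j) = {\<one>} then \<one> else \<theta> i)"
    have "\<zeta> \<in> lamps"
      by (rule lampsI[of _ "{j..j + int w}"]) (use \<theta>(1) assms(1) in \<open>auto simp: \<zeta>_def strip_def\<close>)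
    moreover have "\<eta>' i = \<zeta> i \<otimes> \<eta> (i - j) \<otimes> inv (\<zeta> i)" for i
    proof (cases "\<kappa> (i - j) = {\<one>}")
      case True
      then have "\<eta>' i = \<one>" "\<eta> (i - j) = \<one>" using h(2)[of i] assms(2)[of "i - j"] by auto
      then show ?thesis by (simp add: \<zeta>_def True)
    next
      case False
      then show ?thesis using \<theta>(2)[of i] by (simp add: \<zeta>_def)
    qed
    then have "\<eta>' = (\<lambda>i. \<zeta> i \<otimes> \<eta> (i - j) \<otimes> inv (\<zeta> i))" by blast
    ultimately show "h \<in> W.conj_class (\<eta>, 0)"
      unfolding conj_class_W[OF \<eta>] h(1) by auto
  next
    fix h assume "h \<in> W.conj_class (\<eta>, 0)"
    then obtain \<theta> n where h: "\<theta> \<in> lamps" "h = (\<lambda>i. \<theta> i \<otimes> \<eta> (i - n) \<otimes> inv (\<theta> i), 0)"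
      unfolding conj_class_W[OF \<eta>] by auto
    have "\<theta> i \<otimes> \<eta> (i - n) \<otimes> inv (\<theta> i) \<in> \<kappa> (i - n)" for i
      unfolding \<kappa> conj_class_def using lamps_closed[OF h(1)] by blast
    then show "h \<in> pattern_class \<kappa>" unfolding pattern_class_def h(2) by blast
  qed
qed

lemma minimal_rep:
  assumes "\<kappa> \<in> strip w"
  obtains \<eta> where "\<And>i. \<eta> i \<in> \<kappa> i" "\<And>i. len (\<eta> i) = clen (\<kappa> i)"
proof -
  have "\<exists>x. x \<in> \<kappa> i \<and> len x = clen (\<kappa> i)" for i
    using assms class_length_attained[of "\<kappa> i"] unfolding strip_def by blast
  then show ?thesis using that by metis
qed

lemma pattern_class_in:
  assumes "\<kappa> \<in> strip w" shows "pattern_class \<kappa> \<in> conj_classes W"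
proof -
  obtain \<eta> where \<eta>: "\<And>i. \<eta> i \<in> \<kappa> i" using minimal_rep[OF assms] by metis
  then have "\<eta> \<in> lamps" using strip_rep_lamps[OF assms, of \<eta> 0] by simp
  then show ?thesis using pattern_class_eq[OF assms \<eta>] W.conj_class_in by (simp add: carrier_W)
qed

text \<open>The cursor starts and ends at 0, so a word for a member of the class walks at least twice
  across the support; a minimal word sweeps to the right once, setting the lamps, and returns.\<close>

lemma class_length_pattern:
  assumes "\<kappa> \<in> strip w"
  shows "class_length W V (pattern_class \<kappa>) = strip_len w \<kappa>"
proof -
  obtain \<eta> where \<eta>: "\<And>i. \<eta> i \<in> \<kappa> i" "\<And>i. len (\<eta> i) = clen (\<kappa> i)" using minimal_rep[OF assms] by metis
  have l: "\<eta> \<in> lamps" using strip_rep_lamps[OF assms, of \<eta> 0] \<eta> by simp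
  show ?thesis
  proof (rule W.class_length_eqI)
    show "pattern_class \<kappa> \<in> conj_classes W" by (rule pattern_class_in[OF assms])
    show "(\<eta>, 0) \<in> pattern_class \<kappa>" unfolding pattern_class_def using \<eta>(1) by (auto intro!: exI[of _ 0])
    have out: "\<eta> i = \<one>" if "i < 0 \<or> i > int w" for i using \<eta>(1)[of i] assms that by (auto simp: strip_def)
    have "reach (w + (\<Sum>i\<le>w. len (\<eta> (int i))) + nat \<bar>- int w\<bar>) ((\<eta>, int w) \<otimes>\<^bsub>W\<^esub> (\<lambda>i. \<one>, - int w))"
      by (intro reach_mult reach_strip reach_move l out)
    moreover have "(\<eta>, int w) \<otimes>\<^bsub>W\<^esub> (\<lambda>i. \<one>, - int w) = (\<eta>, 0)" using lamps_closed[OF l] by (simp add: mult_W)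
    moreover have "(\<Sum>i\<le>w. len (\<eta> (int i))) = (\<Sum>i\<in>{0..int w}. clen (\<kappa> i))"
      by (rule sum.reindex_bij_witness[of _ nat int]) (auto simp: \<eta>(2))
    then have "w + (\<Sum>i\<le>w. len (\<eta> (int i))) + nat \<bar>- int w\<bar> = strip_len w \<kappa>" by (simp add: strip_len_def)
    ultimately have "reach (strip_len w \<kappa>) (\<eta>, 0)" by metis
    then show "W.len (\<eta>, 0) \<le> strip_len w \<kappa>" by (rule len_W_le_reach)
  next
    fix g assume "g \<in> pattern_class \<kappa>"
    then obtain \<eta>' j where g: "g = (\<eta>', 0)" "\<And>i. \<eta>' i \<in> \<kappa> (i - j)" by (auto simp: pattern_class_def)
    have l': "\<eta>' \<in> lamps" by (rule strip_rep_lamps[OF assms g(2)])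
    have "\<one> \<notin> \<kappa> 0" "\<one> \<notin> \<kappa> (int w)"
      using strip_trivial[OF assms] assms unfolding strip_def by blast+
    then have "\<eta>' j \<noteq> \<one>" "\<eta>' (j + int w) \<noteq> \<one>" using g(2)[of j] g(2)[of "j + int w"] by auto
    then have "2 * w + lamp_len \<eta>' \<le> W.len (\<eta>', 0)" using len_W_ge_span[OF l', of j "j + int w"] by simp
    moreover have "(\<Sum>i\<in>{0..int w}. clen (\<kappa> i)) \<le> lamp_len \<eta>'"
    proof -
      have "(\<Sum>i\<in>{0..int w}. clen (\<kappa> i)) = (\<Sum>i\<in>{j..j + int w}. clen (\<kappa> (i - j)))"
        by (rule sum.reindex_bij_witness[of _ "\<lambda>i. i - j" "\<lambda>i. i + j"]) auto
      also have "\<dots> \<le> (\<Sum>i\<in>{j..j + int w}. len (\<eta>' i))" by (intro sum_mono class_length_le g(2))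
      also have "\<dots> \<le> lamp_len \<eta>'" by (rule sum_le_lamp_len[OF l']) simp
      finally show ?thesis .
    qed
    ultimately show "strip_len w \<kappa> \<le> W.len g" using g(1) by (simp add: strip_len_def)
  qed
qed

lemma pattern_class_inj:
  assumes "\<kappa> \<in> strip w" "\<kappa>' \<in> strip w'" "pattern_class \<kappa> = pattern_class \<kappa>'"
  shows "\<kappa> = \<kappa>'" "w = w'"
proof -
  obtain \<eta> where \<eta>: "\<And>i. \<eta> i \<in> \<kappa> i" using minimal_rep[OF assms(1)] by metis
  then have "(\<eta>, 0) \<in> pattern_class \<kappa>" unfolding pattern_class_def by (auto intro!: exI[of _ 0])
  then obtain j where j: "\<And>i. \<eta> i \<in> \<kappa>' (i - j)" unfolding assms(3) by (auto simp: pattern_class_def)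
  have cls: "\<kappa> i \<in> conj_classes H" "\<kappa>' i \<in> conj_classes H" for i
    using assms(1,2) by (auto simp: strip_def)
  have eq: "\<kappa> i = \<kappa>' (i - j)" for i
    using conj_class_memD(2)[OF cls(1) \<eta>[of i]] conj_class_memD(2)[OF cls(2) j[of i]] by simp
  have "\<kappa>' (- j) \<noteq> {\<one>}" using eq[of 0] assms(1) by (simp add: strip_def)
  moreover have "\<kappa> j \<noteq> {\<one>}" using eq[of j] assms(2) by (simp add: strip_def)
  moreover have "\<And>i. i < 0 \<Longrightarrow> \<kappa> i = {\<one>}" "\<And>i. i < 0 \<Longrightarrow> \<kappa>' i = {\<one>}"
    using assms(1,2) unfolding strip_def by blast+
  ultimately have "\<not> j < 0" "\<not> - j < 0" by blast+
  then have "j = 0" by simp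
  then show e: "\<kappa> = \<kappa>'" using eq by auto
  have "\<not> int w > int w'" "\<not> int w' > int w" using assms(1,2) unfolding strip_def e by blast+
  then show "w = w'" by simp
qed

lemma pattern_class_surj:
  assumes "\<eta> \<in> lamps" "\<eta> \<noteq> (\<lambda>i. \<one>)"
  obtains \<kappa> w where "\<kappa> \<in> strip w" "W.conj_class (\<eta>, 0) = pattern_class \<kappa>"
proof -
  let ?S = "{i. \<eta> i \<noteq> \<one>}"
  have S: "finite ?S" "?S \<noteq> {}" using lamps_finite assms by auto
  define a b where "a = Min ?S" and "b = Max ?S"
  have ab: "\<eta> a \<noteq> \<one>" "\<eta> b \<noteq> \<one>" using Min_in[OF S] Max_in[OF S] by (auto simp: a_def b_def)
  have out: "\<eta> i = \<one>" if "i < a \<or> i > b" for i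
    using that Min_le[OF S(1), of i] Max_ge[OF S(1), of i] unfolding a_def b_def by fastforce
  have "a \<le> b" using out ab by (meson not_less)
  define \<theta> where "\<theta> = (\<lambda>i. \<eta> (i + a))"
  define \<kappa> where "\<kappa> = (\<lambda>i. conj_class (\<theta> i))"
  have \<theta>: "\<theta> \<in> lamps" unfolding \<theta>_def by (rule lamps_shift(1)[OF assms(1)])
  have rep: "\<theta> i \<in> \<kappa> i" for i unfolding \<kappa>_def using conj_class_refl lamps_closed[OF \<theta>] by blast
  have "\<kappa> 0 \<noteq> {\<one>}" "\<kappa> (b - a) \<noteq> {\<one>}" using rep[of 0] rep[of "b - a"] ab by (auto simp: \<theta>_def)
  then have \<kappa>: "\<kappa> \<in> strip (nat (b - a))"
    using out \<open>a \<le> b\<close> conj_class_in lamps_closed[OF \<theta>]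
    by (auto simp: strip_def \<kappa>_def \<theta>_def conj_class_one)
  have "(\<theta>, 0) \<in> W.conj_class (\<eta>, 0)"
    unfolding conj_class_W[OF assms(1)]
    by (intro CollectI exI[of _ "\<lambda>i. \<one>"] exI[of _ "- a"])
      (auto simp: lamps_one lamps_closed[OF assms(1)] \<theta>_def)
  then have "W.conj_class (\<eta>, 0) = W.conj_class (\<theta>, 0)"
    using W.conj_class_eq[of "(\<eta>, 0)"] assms(1) by (simp add: carrier_W)
  also have "\<dots> = pattern_class \<kappa>" by (rule pattern_class_eq[symmetric, OF \<kappa> rep])
  finally show ?thesis using that \<kappa> by blast
qed

lemma nontrivial_classes_series:
  "weight_series (conj_classes H - {{\<one>}}) clen = conj_growth_series H Z - 1"
  (is "weight_series ?N clen = ?c - 1")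
proof (rule fps_ext)
  fix k
  show "fps_nth (weight_series ?N clen) k = fps_nth (?c - 1) k"
  proof (cases "k = 0")
    case True
    have "{C \<in> conj_classes H. clen C = 0} = {{\<one>}}" "{C \<in> ?N. clen C = 0} = {}"
      using class_length_eq_0_iff one_class_in by auto
    then have "card {C \<in> conj_classes H. clen C = 0} = 1" "card {C \<in> ?N. clen C = 0} = 0"
      by (simp_all only: card.empty) simp
    then show ?thesis unfolding True weight_series_def conj_growth_series_def by (simp only: fps_nth_Abs_fps fps_sub_nth) simp
  next
    case False
    have "{C \<in> ?N. clen C = k} = {C \<in> conj_classes H. clen C = k}"
      using False class_length_eq_0_iff[OF one_class_in] by auto
    then show ?thesis using False by (simp add: weight_series_def conj_growth_series_def)
  qed
qed

text \<open>The two ends of the strip carry nontrivial classes, the positions between them arbitrary ones; for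
  w = 0 the ends coincide.\<close>

lemma card_strip:
  "finite {\<kappa> \<in> strip w. strip_len w \<kappa> = n}"
  "real (card {\<kappa> \<in> strip w. strip_len w \<kappa> = n}) =
     fps_nth (fps_X ^ (2 * w) * (if w = 0 then conj_growth_series H Z - 1
       else (conj_growth_series H Z - 1)\<^sup>2 * conj_growth_series H Z ^ (w - 1))) n"
proof -
  let ?c = "conj_growth_series H Z"
  let ?N = "conj_classes H - {{\<one>}}"
  define A where "A = (\<lambda>i. if i = 0 \<or> i = int w then ?N else conj_classes H)"
  have c: "weight_series (conj_classes H) clen = ?c"
    by (simp add: weight_series_def conj_growth_series_def)
  have N: "weight_series ?N clen = ?c - 1" by (rule nontrivial_classes_series)
  let ?F = "\<lambda>k. {\<kappa>. (\<forall>i\<in>{0..int w}. \<kappa> i \<in> A i) \<and> (\<forall>i. i \<notin> {0..int w} \<longrightarrow> \<kappa> i = {\<one>}) \<and>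
      (\<Sum>i\<in>{0..int w}. clen (\<kappa> i)) = k}"
  have eq: "{\<kappa> \<in> strip w. strip_len w \<kappa> = n} = (if 2 * w \<le> n then ?F (n - 2 * w) else {})"
  proof -
    have "\<kappa> \<in> strip w \<longleftrightarrow> (\<forall>i\<in>{0..int w}. \<kappa> i \<in> A i) \<and> (\<forall>i. i \<notin> {0..int w} \<longrightarrow> \<kappa> i = {\<one>})" for \<kappa>
    proof
      assume "\<kappa> \<in> strip w"
      then show "(\<forall>i\<in>{0..int w}. \<kappa> i \<in> A i) \<and> (\<forall>i. i \<notin> {0..int w} \<longrightarrow> \<kappa> i = {\<one>})"
        by (auto simp: strip_def A_def)
    next
      assume R: "(\<forall>i\<in>{0..int w}. \<kappa> i \<in> A i) \<and> (\<forall>i. i \<notin> {0..int w} \<longrightarrow> \<kappa> i = {\<one>})"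
      then have "\<kappa> 0 \<in> ?N" "\<kappa> (int w) \<in> ?N" by (auto simp: A_def dest: bspec[of _ _ 0] bspec[of _ _ "int w"])
      moreover have "\<kappa> i \<in> conj_classes H" for i
        using R one_class_in by (cases "i \<in> {0..int w}") (auto simp: A_def split: if_splits)
      ultimately show "\<kappa> \<in> strip w" using R by (auto simp: strip_def)
    qed
    then show ?thesis by (auto simp: strip_len_def)
  qed
  have prod: "(\<Prod>i\<in>{0..int w}. weight_series (A i) clen) =
      (if w = 0 then ?c - 1 else (?c - 1)\<^sup>2 * ?c ^ (w - 1))"
  proof (cases "w = 0")
    case True
    then show ?thesis by (simp add: A_def N)
  next
    case False
    then have "{0..int w} = insert 0 (insert (int w) {1..int w - 1})" by auto
    moreover have "(\<Prod>i\<in>{1..int w - 1}. weight_series (A i) clen) = (\<Prod>i\<in>{1..int w - 1}. ?c)"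
      by (rule prod.cong) (auto simp: A_def c)
    moreover have "nat (int w - 1) = w - 1" by simp
    ultimately show ?thesis using False by (simp add: A_def N power2_eq_square mult.assoc)
  qed
  have "finite {C \<in> A i. clen C = k}" for i k
    by (rule finite_subset[OF _ finite_classes_of_length[of k]]) (auto simp: A_def)
  then have F: "finite (?F k)" "real (card (?F k)) = fps_nth (\<Prod>i\<in>{0..int w}. weight_series (A i) clen) k" for k
    using card_weighted_functions[where I="{0..int w}" and A=A and l=clen and n=k and d="{\<one>}"] by auto
  show "finite {\<kappa> \<in> strip w. strip_len w \<kappa> = n}" unfolding eq using F(1) by simp
  show "real (card {\<kappa> \<in> strip w. strip_len w \<kappa> = n}) =
     fps_nth (fps_X ^ (2 * w) * (if w = 0 then ?c - 1 else (?c - 1)\<^sup>2 * ?c ^ (w - 1))) n"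
    unfolding eq prod[symmetric] using F(2)[of "n - 2 * w"] by (simp add: fps_X_power_mult_nth)
qed

text \<open>The summand 1 is the class of the neutral element. A pattern in a strip of width w has
  length at least 2 w, so the terms with w > n vanish; summing up to Suc n leaves exactly n + 1 terms
  for the geometric series once w = 0 is split off.\<close>

lemma card_classes_still:
  "real (card (classes_at 0 n)) =
     fps_nth (1 + (\<Sum>w\<le>Suc n. fps_X ^ (2 * w) * (if w = 0 then conj_growth_series H Z - 1
       else (conj_growth_series H Z - 1)\<^sup>2 * conj_growth_series H Z ^ (w - 1)))) n"
proof -
  let ?S = "SIGMA w:{..Suc n}. {\<kappa> \<in> strip w. strip_len w \<kappa> = n}"
  let ?T = "if n = 0 then {W.conj_class (\<lambda>i. \<one>, 0)} else {}"
  have one: "W.conj_class (\<lambda>i. \<one>, 0) = {(\<lambda>i. \<one>, 0)}" using W.conj_class_one by (simp add: one_W)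
  have one_len: "class_length W V {(\<lambda>i. \<one>, 0)} = 0"
    using W.class_length_eq_0_iff[OF W.one_class_in] by (simp add: one_W)
  have non: "pattern_class \<kappa> \<noteq> {(\<lambda>i. \<one>, 0)}" if \<kappa>: "\<kappa> \<in> strip w" for \<kappa> w
  proof
    assume "pattern_class \<kappa> = {(\<lambda>i. \<one>, 0)}"
    then have "(\<lambda>i. \<one>, 0) \<in> pattern_class \<kappa>" by simp
    then obtain j where "\<And>i. \<one> \<in> \<kappa> (i - j)" by (auto simp: pattern_class_def)
    from this[of j] show False using strip_trivial[OF \<kappa>] \<kappa> by (auto simp: strip_def)
  qed
  have eq: "classes_at 0 n = ?T \<union> (\<lambda>(w, \<kappa>). pattern_class \<kappa>) ` ?S"
  proof (intro equalityI subsetI)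
    fix C assume C: "C \<in> classes_at 0 n"
    obtain \<eta> where \<eta>: "\<eta> \<in> lamps" "C = W.conj_class (\<eta>, 0)" using classes_atE[OF C] .
    show "C \<in> ?T \<union> (\<lambda>(w, \<kappa>). pattern_class \<kappa>) ` ?S"
    proof (cases "\<eta> = (\<lambda>i. \<one>)")
      case True
      then show ?thesis using C \<eta>(2) one one_len by (auto simp: classes_at_def)
    next
      case False
      obtain \<kappa> w where \<kappa>: "\<kappa> \<in> strip w" "C = pattern_class \<kappa>" using pattern_class_surj[OF \<eta>(1) False] \<eta>(2) by metis
      then have "strip_len w \<kappa> = n" using C class_length_pattern[OF \<kappa>(1)] by (simp add: classes_at_def)
      moreover from this have "w \<le> Suc n" by (simp add: strip_len_def)
      ultimately show ?thesis using \<kappa> by (auto intro!: image_eqI[of _ _ "(w, \<kappa>)"])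
    qed
  next
    fix C assume "C \<in> ?T \<union> (\<lambda>(w, \<kappa>). pattern_class \<kappa>) ` ?S"
    then show "C \<in> classes_at 0 n"
    proof
      assume "C \<in> ?T"
      then show ?thesis using one one_len W.one_class_in by (auto simp: classes_at_def one_W split: if_splits)
    next
      assume "C \<in> (\<lambda>(w, \<kappa>). pattern_class \<kappa>) ` ?S"
      then obtain w \<kappa> where \<kappa>: "\<kappa> \<in> strip w" "strip_len w \<kappa> = n" "C = pattern_class \<kappa>" by auto
      obtain h where "h \<in> C" using W.conj_class_nonempty[OF pattern_class_in[OF \<kappa>(1)]] \<kappa>(3) by auto
      then have "snd ` C = {0}" unfolding \<kappa>(3) by (force simp: pattern_class_def)
      then show ?thesis using pattern_class_in class_length_pattern \<kappa> by (simp add: classes_at_def)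
    qed
  qed
  have fin: "finite ?S" using card_strip(1) by auto
  have "card (classes_at 0 n) = card ?T + card ((\<lambda>(w, \<kappa>). pattern_class \<kappa>) ` ?S)"
    unfolding eq by (rule card_Un_disjoint) (use fin one non in \<open>auto split: if_splits\<close>)
  also have "card ((\<lambda>(w, \<kappa>). pattern_class \<kappa>) ` ?S) = card ?S"
    by (rule card_image) (auto simp: inj_on_def dest: pattern_class_inj)
  also have "card ?S = (\<Sum>w\<le>Suc n. card {\<kappa> \<in> strip w. strip_len w \<kappa> = n})"
    by (rule card_SigmaI) (use card_strip(1) in auto)
  finally show ?thesis by (simp add: card_strip(2) fps_sum_nth del: sum.atMost_Suc)
qed

lemma card_classes_still_series:
  "real (card (classes_at 0 n)) =
     fps_nth (conj_growth_series H Z + fps_X\<^sup>2 * (conj_growth_series H Z - 1)\<^sup>2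
       / (1 - fps_X\<^sup>2 * conj_growth_series H Z)) n"
proof -
  let ?c = "conj_growth_series H Z"
  have "(\<Sum>w\<le>Suc n. fps_X ^ (2 * w) * (if w = 0 then ?c - 1 else (?c - 1)\<^sup>2 * ?c ^ (w - 1)))
     = (?c - 1) + (\<Sum>v\<le>n. fps_X ^ (2 * Suc v) * ((?c - 1)\<^sup>2 * ?c ^ v))"
    by (subst sum.atMost_Suc_shift) simp
  also have "(\<Sum>v\<le>n. fps_X ^ (2 * Suc v) * ((?c - 1)\<^sup>2 * ?c ^ v)) =
      fps_X\<^sup>2 * (?c - 1)\<^sup>2 * (\<Sum>v\<le>n. (fps_X\<^sup>2 * ?c) ^ v)"
    unfolding sum_distrib_left
  proof (rule sum.cong)
    fix v
    have "fps_X ^ (2 * Suc v) = (fps_X\<^sup>2 * (fps_X\<^sup>2) ^ v :: real fps)" by (simp only: power_mult power_Suc)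
    then show "fps_X ^ (2 * Suc v) * ((?c - 1)\<^sup>2 * ?c ^ v) = fps_X\<^sup>2 * (?c - 1)\<^sup>2 * (fps_X\<^sup>2 * ?c) ^ v"
      by (simp only: power_mult_distrib mult_ac)
  qed simp
  finally show ?thesis
    unfolding card_classes_still by (simp add: fps_divide_one_minus_nth)
qed

end

section \<open>Power series\<close>

text \<open>Only the first n members contribute to coefficient n, so the partial sums converge coefficientwise.\<close>

lemma fps_has_sum_triangular:
  fixes F :: "nat \<Rightarrow> 'a :: ab_group_add fps"
  assumes "\<And>s n. n < s \<Longrightarrow> fps_nth (F s) n = 0"
  shows "(F has_sum Abs_fps (\<lambda>n. \<Sum>s=1..n. fps_nth (F s) n)) {1..}"
proof (rule has_sum_fpsI)
  fix n
  have sub: "{s \<in> {1..}. fps_nth (F s) n \<noteq> 0} \<subseteq> {1..n}" using assms by (auto simp: not_less[symmetric])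
  show "finite {s \<in> {1..}. fps_nth (F s) n \<noteq> 0}" by (rule finite_subset[OF sub]) simp
  show "fps_nth (Abs_fps (\<lambda>n. \<Sum>s=1..n. fps_nth (F s) n)) n =
      (\<Sum>s | s \<in> {1..} \<and> fps_nth (F s) n \<noteq> 0. fps_nth (F s) n)"
    using sub by (simp, intro sum.mono_neutral_right) auto
qed

lemma fps_X_power_mult_nth_less: "n < k \<Longrightarrow> fps_nth (fps_X ^ k * a) n = (0 :: 'a :: comm_ring_1)"
  by (simp add: fps_X_power_mult_nth)

definition necklace_term :: "real fps \<Rightarrow> nat \<Rightarrow> nat \<Rightarrow> real fps" where
  "necklace_term S r s = fps_const (1 / real s) * (fps_X ^ (r * s) * (S oo fps_X ^ r) ^ s)"

definition necklace_sum :: "real fps \<Rightarrow> nat \<Rightarrow> real fps" where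
  "necklace_sum S r = fps_const (real (totient r) / real r) * (\<Sum>\<^sub>\<infinity>s\<in>{1..}. necklace_term S r s)"

lemma necklace_term_has_sum:
  assumes "r \<ge> 1"
  shows "(necklace_term S r has_sum Abs_fps (\<lambda>n. \<Sum>s=1..n. fps_nth (necklace_term S r s) n)) {1..}"
proof (rule fps_has_sum_triangular)
  fix s n :: nat assume "n < s"
  then have "n < r * s" using assms by (metis le_trans mult_le_mono1 nat_mult_1 not_less)
  then show "fps_nth (necklace_term S r s) n = 0"
    by (simp add: necklace_term_def fps_X_power_mult_nth_less)
qed

lemma necklace_sum_nth:
  assumes "r \<ge> 1"
  shows "fps_nth (necklace_sum S r) n =
     real (totient r) / real r * (\<Sum>s=1..n. fps_nth (necklace_term S r s) n)"
  unfolding necklace_sum_def using infsumI[OF necklace_term_has_sum[OF assms, of S]] by simp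

lemma necklace_sum_has_sum:
  "(necklace_sum S has_sum Abs_fps (\<lambda>n. \<Sum>r=1..n. fps_nth (necklace_sum S r) n)) {1..}"
proof (rule fps_has_sum_triangular)
  fix r n :: nat assume "n < r"
  have "fps_nth (necklace_term S r s) n = 0" if "s \<in> {1..n}" for s
  proof -
    have "n < r * s" using \<open>n < r\<close> that by (metis atLeastAtMost_iff le_trans mult_le_mono2 nat_mult_1_right not_less)
    then show ?thesis by (simp add: necklace_term_def fps_X_power_mult_nth_less)
  qed
  then show "fps_nth (necklace_sum S r) n = 0" using \<open>n < r\<close> by (simp add: necklace_sum_nth)
qed

text \<open>Burnside's formula for necklaces of length m is a sum over the divisors r of m; writing m = r s turns the
  sum over all lengths into a double sum over r and s.\<close>

lemma (in weighted_alphabet) necklace_sum_eq_card: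
  "(\<Sum>m=1..n. real (card (necklaces A l m (n - m)))) =
     fps_nth (\<Sum>\<^sub>\<infinity>r\<in>{1..}. necklace_sum (weight_series A l) r) n"
proof -
  let ?S = "weight_series A l"
  let ?T = "\<lambda>(r, s). real (totient r) / real (r * s) * fps_nth ((?S oo fps_X ^ r) ^ s) (n - r * s)"
  let ?D = "{(r, s). r \<in> {1..n} \<and> s \<in> {1..n} \<and> r * s \<le> n}"
  have "(\<Sum>m=1..n. real (card (necklaces A l m (n - m)))) =
      (\<Sum>m=1..n. \<Sum>r | r dvd m. real (totient r) / real m * fps_nth ((?S oo fps_X ^ r) ^ (m div r)) (n - m))"
    by (rule sum.cong) (auto simp: card_necklaces)
  also have "\<dots> = (\<Sum>(m, r)\<in>(SIGMA m:{1..n}. {r. r dvd m}).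
      real (totient r) / real m * fps_nth ((?S oo fps_X ^ r) ^ (m div r)) (n - m))"
    by (rule sum.Sigma) auto
  also have "\<dots> = (\<Sum>x\<in>?D. ?T x)"
  proof (rule sum.reindex_bij_witness[of _ "\<lambda>(r, s). (r * s, r)" "\<lambda>(m, r). (r, m div r)"])
    fix x assume "x \<in> (SIGMA m:{1..n}. {r. r dvd m})"
    then obtain m r s where x: "x = (m, r)" "m = r * s" "1 \<le> m" "m \<le> n" by auto
    have "r \<ge> 1" "s \<ge> 1" "r \<le> m" "s \<le> m" using x(2,3) by auto
    then have "r \<ge> 1" "s \<ge> 1" "r \<le> n" "s \<le> n" using x(4) by linarith+
    then show "(case case x of (m, r) \<Rightarrow> (r, m div r) of (r, s) \<Rightarrow> (r * s, r)) = x"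
      "(case x of (m, r) \<Rightarrow> (r, m div r)) \<in> ?D"
      "?T (case x of (m, r) \<Rightarrow> (r, m div r)) = (case x of (m, r) \<Rightarrow>
        real (totient r) / real m * fps_nth ((?S oo fps_X ^ r) ^ (m div r)) (n - m))"
      using x by auto
  next
    fix y assume "y \<in> ?D"
    then obtain r s where "y = (r, s)" "1 \<le> r" "1 \<le> s" "r * s \<le> n" by auto
    then show "(case case y of (r, s) \<Rightarrow> (r * s, r) of (m, r) \<Rightarrow> (r, m div r)) = y"
      "(case y of (r, s) \<Rightarrow> (r * s, r)) \<in> (SIGMA m:{1..n}. {r. r dvd m})" by auto
  qed
  also have "\<dots> = (\<Sum>x\<in>?D. case x of (r, s) \<Rightarrow>
      real (totient r) / real r * fps_nth (necklace_term ?S r s) n)"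
    by (rule sum.cong) (auto simp: necklace_term_def fps_X_power_mult_nth)
  also have "\<dots> = (\<Sum>x\<in>{1..n} \<times> {1..n}. case x of (r, s) \<Rightarrow>
      real (totient r) / real r * fps_nth (necklace_term ?S r s) n)"
    by (rule sum.mono_neutral_left) (auto simp: necklace_term_def fps_X_power_mult_nth split: if_splits)
  also have "\<dots> = (\<Sum>r=1..n. fps_nth (necklace_sum ?S r) n)"
    by (subst sum.cartesian_product[symmetric]) (simp add: necklace_sum_nth sum_distrib_left)
  finally show ?thesis using infsumI[OF necklace_sum_has_sum[of ?S]] by simp
qed

section \<open>The radius of convergence\<close>

lemma fps_mult_nth_mono:
  fixes a b c d :: "real fps"
  assumes "\<And>n. 0 \<le> fps_nth a n" "\<And>n. fps_nth a n \<le> fps_nth b n"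
    and "\<And>n. 0 \<le> fps_nth c n" "\<And>n. fps_nth c n \<le> fps_nth d n"
  shows "0 \<le> fps_nth (a * c) n" "fps_nth (a * c) n \<le> fps_nth (b * d) n"
proof -
  show "0 \<le> fps_nth (a * c) n" unfolding fps_mult_nth by (intro sum_nonneg mult_nonneg_nonneg assms)
  have "0 \<le> fps_nth b k" for k using assms(1,2)[of k] by linarith
  then show "fps_nth (a * c) n \<le> fps_nth (b * d) n"
    unfolding fps_mult_nth by (intro sum_mono mult_mono assms)
qed

lemma fps_power_nth_mono:
  fixes a b :: "real fps"
  assumes "\<And>n. 0 \<le> fps_nth a n" "\<And>n. fps_nth a n \<le> fps_nth b n"
  shows "0 \<le> fps_nth (a ^ k) n \<and> fps_nth (a ^ k) n \<le> fps_nth (b ^ k) n"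
proof (induction k arbitrary: n)
  case (Suc k)
  then show ?case using fps_mult_nth_mono[of a b "a ^ k" "b ^ k"] assms by auto
qed auto

lemma fps_nth_mult_power_le_eval:
  fixes f :: "real fps"
  assumes "\<And>n. 0 \<le> fps_nth f n" "0 \<le> u" "ereal u < fps_conv_radius f"
  shows "fps_nth f n * u ^ n \<le> eval_fps f u"
proof -
  have "summable (\<lambda>n. fps_nth f n * u ^ n)" using assms by (intro summable_fps) simp
  then have "(\<Sum>k\<in>{n}. fps_nth f k * u ^ k) \<le> (\<Sum>k. fps_nth f k * u ^ k)"
    using assms by (intro sum_le_suminf) auto
  then show ?thesis by (simp add: eval_fps_def)
qed

lemma conv_radius_geI_bounded:
  fixes f :: "nat \<Rightarrow> real"
  assumes "u > 0" "\<And>n. \<bar>f n\<bar> * u ^ n \<le> M"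
  shows "conv_radius f \<ge> ereal u"
proof (rule conv_radius_geI_ex')
  fix r assume "0 < r" "ereal r < ereal u"
  then have "summable (\<lambda>n. norm (f n) * r ^ n)" using assms by (intro Abel_lemma[where M = M]) auto
  then have "summable (\<lambda>n. norm (f n * r ^ n))" using \<open>0 < r\<close> by (simp add: abs_mult)
  from summable_norm_cancel[OF this] show "summable (\<lambda>n. f n * of_real r ^ n)" by simp
qed

text \<open>The radius of convergence is positive because a(n) \<le> a(1)^n for the coefficients a of S. If it is
  a finite R, then submultiplicativity gives a(n) R^n \<ge> 1 for every n:
  a single strict failure would persist at a slightly larger radius and propagate to all
  multiples of n. Comparison with the geometric series in u / R then gives u S(u) \<ge> 1
  at u = R / (R + 1), which is inside the disc.\<close>

lemma submultiplicative_reaches_one: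
  fixes S :: "real fps"
  assumes S0: "fps_nth S 0 = 1" and nn: "\<And>n. 0 \<le> fps_nth S n"
    and sub: "\<And>m n. fps_nth S (m + n) \<le> fps_nth S m * fps_nth S n"
  shows "\<exists>u>0. ereal u < fps_conv_radius S \<and> u * eval_fps S u \<ge> 1"
proof (cases "fps_conv_radius S = \<infinity>")
  case True
  then have "1 \<le> eval_fps S 1" using fps_nth_mult_power_le_eval[of S 1 0] nn S0 by simp
  then show ?thesis using True by (intro exI[of _ 1]) auto
next
  case False
  let ?a = "fps_nth S"
  have pos: "fps_conv_radius S > 0"
  proof -
    define u where "u = 1 / (?a 1 + 1)"
    have u: "u > 0" "?a 1 * u \<le> 1" using nn[of 1] by (auto simp: u_def field_simps)
    have "?a n * u ^ n \<le> 1" for n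
    proof (induction n)
      case (Suc n)
      have "?a (Suc n) * u ^ Suc n \<le> (?a 1 * ?a n) * u ^ Suc n"
        using sub[of 1 n] u by (intro mult_right_mono) auto
      also have "\<dots> = (?a 1 * u) * (?a n * u ^ n)" by (simp add: mult_ac)
      also have "\<dots> \<le> 1 * 1" using Suc u nn by (intro mult_mono) auto
      finally show ?case by simp
    qed (simp add: S0)
    then have "fps_conv_radius S \<ge> ereal u"
      unfolding fps_conv_radius_def using u nn by (intro conv_radius_geI_bounded[of _ _ 1]) auto
    then show ?thesis using u(1) by (meson ereal_less(2) less_le_trans)
  qed
  then obtain R where R: "fps_conv_radius S = ereal R" "R > 0"
    using False by (cases "fps_conv_radius S") auto
  have ge1: "?a n * R ^ n \<ge> 1" for n
  proof (rule ccontr)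
    assume less: "\<not> ?a n * R ^ n \<ge> 1"
    then have n: "n > 0" using S0 by (cases n) auto
    have "((\<lambda>x. ?a n * x ^ n) \<longlongrightarrow> ?a n * R ^ n) (at_right R)" by (intro tendsto_intros)
    then have "eventually (\<lambda>x. ?a n * x ^ n < 1) (at_right R)" using less by (intro order_tendstoD) auto
    then have "eventually (\<lambda>x. ?a n * x ^ n < 1 \<and> x > R) (at_right R)"
      using eventually_at_right_less by eventually_elim auto
    then obtain x where x: "?a n * x ^ n < 1" "x > R"
      using eventually_happens[of _ "at_right R"] by auto
    define M where "M = (\<Sum>j<n. ?a j * x ^ j)"
    have xp: "x > 0" using x R by simp
    have "?a k * x ^ k \<le> M" for k
    proof (induction k rule: less_induct)
      case (less k)
      show ?case
      proof (cases "k < n")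
        case True
        then show ?thesis unfolding M_def using nn xp by (intro member_le_sum) auto
      next
        case False
        then have k: "k = n + (k - n)" by simp
        have "?a k * x ^ k \<le> (?a n * ?a (k - n)) * x ^ k"
          using sub[of n "k - n"] xp False by (intro mult_right_mono) auto
        also have "\<dots> = (?a n * x ^ n) * (?a (k - n) * x ^ (k - n))"
          by (subst (2) k) (simp add: power_add mult_ac)
        also have "\<dots> \<le> 1 * (?a (k - n) * x ^ (k - n))"
          using x nn xp by (intro mult_right_mono) auto
        also have "\<dots> \<le> M" using less[of "k - n"] False n by simp
        finally show ?thesis .
      qed
    qed
    then have "fps_conv_radius S \<ge> ereal x"
      unfolding fps_conv_radius_def using xp nn by (intro conv_radius_geI_bounded[of _ _ M]) auto
    then show False using R x by simp
  qed
  define u where "u = R / (R + 1)"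
  have u: "u > 0" "u < R" using R by (auto simp: u_def field_simps)
  have q: "u / R = 1 / (R + 1)" using R by (simp add: u_def)
  have sm: "summable (\<lambda>n. ?a n * u ^ n)" using u R by (intro summable_fps) simp
  have "(\<Sum>n. (u / R) ^ n) \<le> (\<Sum>n. ?a n * u ^ n)"
  proof (rule suminf_le)
    fix n
    have "(u / R) ^ n * 1 \<le> (u / R) ^ n * (?a n * R ^ n)" using ge1 u R by (intro mult_left_mono) auto
    then show "(u / R) ^ n \<le> ?a n * u ^ n" using R by (simp add: power_divide mult.commute)
  qed (use sm R in \<open>auto simp: q intro!: summable_geometric\<close>)
  moreover have "(\<Sum>n. (u / R) ^ n) = 1 / (1 - u / R)" using R by (intro suminf_geometric) (simp add: q)
  ultimately have "1 / (1 - u / R) \<le> eval_fps S u" by (simp add: eval_fps_def)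
  moreover have "1 - u / R = u" unfolding q using R by (simp add: u_def field_simps)
  then have "u * (1 / (1 - u / R)) = 1" using u by simp
  ultimately have "u * eval_fps S u \<ge> 1" using u(1) by (metis mult_left_mono less_imp_le)
  then show ?thesis using u R by auto
qed

text \<open>As x S(x) is continuous, vanishes at 0 and reaches 1 inside the disc, it takes the value 1 there;
  it is strictly increasing wherever S converges, including the boundary of the disc.\<close>

lemma unique_solution:
  fixes S :: "real fps"
  assumes S0: "fps_nth S 0 = 1" and nn: "\<And>n. 0 \<le> fps_nth S n"
    and sub: "\<And>m n. fps_nth S (m + n) \<le> fps_nth S m * fps_nth S n"
  obtains t where "t > 0" "ereal t < fps_conv_radius S" "t * eval_fps S t = 1"
    "\<forall>u. (u > 0 \<and> summable (\<lambda>n. fps_nth S n * u ^ n) \<and> u * eval_fps S u = 1) \<longleftrightarrow> u = t"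
proof -
  obtain v where v: "v > 0" "ereal v < fps_conv_radius S" "v * eval_fps S v \<ge> 1"
    using submultiplicative_reaches_one[OF assms] by blast
  have "{0..v} \<subseteq> eball 0 (fps_conv_radius S)"
  proof
    fix x assume "x \<in> {0..v}"
    then have "ereal x \<le> ereal v" by simp
    then show "x \<in> eball 0 (fps_conv_radius S)"
      using v(2) \<open>x \<in> {0..v}\<close> by (simp add: in_eball_iff) (metis ereal_less_eq(3) le_less_trans)
  qed
  then have "continuous_on {0..v} (eval_fps S)" by (rule continuous_on_subset[OF continuous_on_eval_fps])
  then have "continuous_on {0..v} (\<lambda>x. x * eval_fps S x)" by (intro continuous_on_mult continuous_on_id)
  then obtain t where t: "0 \<le> t" "t \<le> v" "t * eval_fps S t = 1"
    using IVT'[of "\<lambda>x. x * eval_fps S x" 0 1 v] v by auto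
  have tp: "t > 0" using t by (cases "t = 0") auto
  have tr: "ereal t < fps_conv_radius S" using t v by (metis ereal_less_eq(3) le_less_trans)
  have mono: "\<not> x < y"
    if "x > 0" "y > 0" "summable (\<lambda>n. fps_nth S n * x ^ n)" "summable (\<lambda>n. fps_nth S n * y ^ n)"
      "x * eval_fps S x = 1" "y * eval_fps S y = 1" for x y :: real
  proof
    assume "x < y"
    have "eval_fps S x \<le> eval_fps S y"
      unfolding eval_fps_def using that nn \<open>x < y\<close>
      by (intro suminf_le mult_left_mono power_mono) auto
    then have "x * eval_fps S x \<le> x * eval_fps S y" by (rule mult_left_mono) (use that in simp)
    moreover have "eval_fps S y > 0" using that by (metis zero_less_mult_pos zero_less_one)
    then have "x * eval_fps S y < y * eval_fps S y" using \<open>x < y\<close> by simp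
    ultimately show False using that by simp
  qed
  have ts: "summable (\<lambda>n. fps_nth S n * t ^ n)" using tr tp by (intro summable_fps) simp
  then have "u = t" if "u > 0" "summable (\<lambda>n. fps_nth S n * u ^ n)" "u * eval_fps S u = 1" for u
    using mono[of u t] mono[of t u] that tp t(3) by force
  then have "\<forall>u. (u > 0 \<and> summable (\<lambda>n. fps_nth S n * u ^ n) \<and> u * eval_fps S u = 1) \<longleftrightarrow> u = t"
    using tp ts t(3) by blast
  then show ?thesis by (rule that[OF tp tr t(3)])
qed

text \<open>Here N counts necklaces and M the classes fixing the cursor. With A n for the coefficient of x^n
  in the sum of all powers of x S(x), the assumptions say that N n lies between A n / n and A n. For
  0 < u < t the terms at u of A and of the bound for M are dominated by convergent geometric series in
  u S(u) < 1. If w converged beyond t, then so would its derivative, and with it A at t,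
  although every power of x S(x) contributes 1 there.\<close>

lemma conv_radius_necklace_growth:
  fixes S w :: "real fps" and N M :: "nat \<Rightarrow> real"
  assumes S0: "fps_nth S 0 = 1" and nn: "\<And>n. 0 \<le> fps_nth S n"
    and t: "t > 0" "ereal t < fps_conv_radius S" "t * eval_fps S t = 1"
    and w: "\<And>n. fps_nth w n = 2 * N n + M n"
    and N0: "\<And>n. 0 \<le> N n"
    and N_le: "\<And>n. N n \<le> (\<Sum>m=1..n. fps_nth ((fps_X * S) ^ m) n)"
    and N_ge: "\<And>n. (\<Sum>m=1..n. fps_nth ((fps_X * S) ^ m) n) \<le> real n * N n"
    and M0: "\<And>n. 0 \<le> M n"
    and M_le: "\<And>n. M n \<le> fps_nth (1 + (\<Sum>k\<le>Suc n. fps_X ^ (2 * k) * S ^ Suc k)) n"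
  shows "fps_conv_radius w = ereal t"
proof -
  have nnp: "0 \<le> fps_nth (S ^ k) n" for k n using fps_power_nth_mono[of S S k n] nn by auto
  have X0: "0 \<le> fps_nth (fps_X ^ j :: real fps) n" for j n by (simp add: fps_X_power_nth)
  have nnX: "0 \<le> fps_nth (fps_X ^ j * S ^ k) n" for j k n
    using fps_mult_nth_mono(1)[of "fps_X ^ j" "fps_X ^ j" "S ^ k" "S ^ k"] nnp X0 by auto
  have rad: "ereal u < fps_conv_radius (fps_X ^ j * S ^ k)" if "u \<le> t" for u j k
  proof -
    have "ereal u < fps_conv_radius S" using that t(2) by (metis ereal_less_eq(3) le_less_trans)
    also have "\<dots> \<le> fps_conv_radius (S ^ k)" by (rule fps_conv_radius_power)
    also have "\<dots> = min (fps_conv_radius (fps_X ^ j :: real fps)) (fps_conv_radius (S ^ k))" by simp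
    also have "\<dots> \<le> fps_conv_radius (fps_X ^ j * S ^ k)" by (rule fps_conv_radius_mult)
    finally show ?thesis .
  qed
  have ev: "eval_fps (fps_X ^ j * S ^ k) u = u ^ j * eval_fps S u ^ k" if "0 \<le> u" "u \<le> t" for u j k
  proof -
    have r: "ereal (norm u) < fps_conv_radius S" "ereal (norm u) < fps_conv_radius (S ^ k)"
      using rad[of u 0 1] rad[of u 0 k] that by simp_all
    then show ?thesis by (subst eval_fps_mult) (simp_all add: eval_fps_power)
  qed
  have t1: "t \<le> 1"
  proof -
    have "1 \<le> eval_fps S t" using fps_nth_mult_power_le_eval[of S t 0] nn S0 t by simp
    then show ?thesis using t by (metis mult_left_mono mult.right_neutral less_imp_le)
  qed
  have "fps_conv_radius w \<ge> ereal t"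
    unfolding fps_conv_radius_def
  proof (rule conv_radius_geI_ex')
    fix r assume r: "0 < r" "ereal r < ereal t"
    define u where "u = (r + t) / 2"
    have u: "0 < u" "r < u" "u < t" using r by (auto simp: u_def)
    define E where "E = eval_fps S u"
    define q where "q = u * E"
    have E0: "E \<ge> 0" using fps_nth_mult_power_le_eval[of S u 0] nn S0 u rad[of u 0 1] by (simp add: E_def)
    have "E \<le> eval_fps S t"
      unfolding eval_fps_def E_def using u nn t rad[of u 0 1]
      by (intro suminf_le mult_left_mono power_mono summable_fps) auto
    then have "u * E \<le> u * eval_fps S t" using u by simp
    also have "\<dots> < t * eval_fps S t" using u t by (metis mult_strict_right_mono zero_less_mult_pos zero_less_one)
    finally have q: "0 \<le> q" "q < 1" using t u E0 by (auto simp: q_def)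
    have geo: "(\<Sum>m\<in>I. q ^ m) \<le> 1 / (1 - q)" if "finite I" for I
    proof -
      have "(\<Sum>m\<in>I. q ^ m) \<le> (\<Sum>m. q ^ m)" using q that by (intro sum_le_suminf summable_geometric) auto
      then show ?thesis using q by (simp add: suminf_geometric)
    qed
    have Nb: "N n * u ^ n \<le> 1 / (1 - q)" for n
    proof -
      have "N n * u ^ n \<le> (\<Sum>m=1..n. fps_nth ((fps_X * S) ^ m) n) * u ^ n"
        using N_le u by (intro mult_right_mono) auto
      also have "\<dots> = (\<Sum>m=1..n. fps_nth (fps_X ^ m * S ^ m) n * u ^ n)"
        by (simp add: sum_distrib_right power_mult_distrib)
      also have "\<dots> \<le> (\<Sum>m=1..n. q ^ m)"
      proof (rule sum_mono)
        fix m
        have "fps_nth (fps_X ^ m * S ^ m) n * u ^ n \<le> eval_fps (fps_X ^ m * S ^ m) u"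
          using u nnX rad by (intro fps_nth_mult_power_le_eval) auto
        also have "\<dots> = q ^ m" using u by (simp add: ev q_def E_def power_mult_distrib)
        finally show "fps_nth (fps_X ^ m * S ^ m) n * u ^ n \<le> q ^ m" .
      qed
      also have "\<dots> \<le> 1 / (1 - q)" by (rule geo) simp
      finally show ?thesis .
    qed
    have Mb: "M n * u ^ n \<le> 1 + E * (1 / (1 - q))" for n
    proof -
      have "M n * u ^ n \<le> fps_nth (1 + (\<Sum>k\<le>Suc n. fps_X ^ (2 * k) * S ^ Suc k)) n * u ^ n"
        using M_le u by (intro mult_right_mono) auto
      also have "\<dots> = fps_nth 1 n * u ^ n + (\<Sum>k\<le>Suc n. fps_nth (fps_X ^ (2 * k) * S ^ Suc k) n * u ^ n)"
        by (simp add: fps_sum_nth distrib_right sum_distrib_right del: sum.atMost_Suc power_Suc)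
      also have "\<dots> \<le> 1 + (\<Sum>k\<le>Suc n. E * q ^ k)"
      proof (intro add_mono sum_mono)
        show "fps_nth 1 n * u ^ n \<le> 1" by (cases n) auto
        fix k
        have "fps_nth (fps_X ^ (2 * k) * S ^ Suc k) n * u ^ n \<le> eval_fps (fps_X ^ (2 * k) * S ^ Suc k) u"
          using u by (intro fps_nth_mult_power_le_eval nnX rad) auto
        also have "\<dots> = u ^ (2 * k) * E ^ Suc k" unfolding E_def by (rule ev) (use u in auto)
        also have "\<dots> = E * (u * q) ^ k"
          by (simp add: q_def power_mult_distrib power_mult power2_eq_square mult_ac)
        \<comment> \<open>u \<le> 1, since t S(t) = 1 and S(t) \<ge> 1\<close>
        also have "\<dots> \<le> E * q ^ k"
          using E0 u q t1 by (intro mult_left_mono power_mono) (auto intro: mult_left_le_one_le)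
        finally show "fps_nth (fps_X ^ (2 * k) * S ^ Suc k) n * u ^ n \<le> E * q ^ k" .
      qed
      also have "(\<Sum>k\<le>Suc n. E * q ^ k) = E * (\<Sum>k\<le>Suc n. q ^ k)" by (rule sum_distrib_left[symmetric])
      also have "1 + E * (\<Sum>k\<le>Suc n. q ^ k) \<le> 1 + E * (1 / (1 - q))"
        using E0 geo[of "{..Suc n}"] by (intro add_left_mono mult_left_mono) auto
      finally show ?thesis .
    qed
    have "summable (\<lambda>n. norm (fps_nth w n) * r ^ n)"
    proof (rule Abel_lemma[where M = "2 * (1 / (1 - q)) + (1 + E * (1 / (1 - q)))"])
      fix n
      have "norm (fps_nth w n) * u ^ n = 2 * (N n * u ^ n) + M n * u ^ n"
        using w[of n] N0[of n] M0[of n] by (simp add: algebra_simps)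
      then show "norm (fps_nth w n) * u ^ n \<le> 2 * (1 / (1 - q)) + (1 + E * (1 / (1 - q)))"
        using Nb[of n] Mb[of n] by linarith
    qed (use r u in auto)
    then have "summable (\<lambda>n. norm (fps_nth w n * r ^ n))" using r by (simp add: abs_mult)
    from summable_norm_cancel[OF this] show "summable (\<lambda>n. fps_nth w n * of_real r ^ n)" by simp
  qed
  moreover have "\<not> ereal t < fps_conv_radius w"
  proof
    assume "ereal t < fps_conv_radius w"
    also have "\<dots> \<le> fps_conv_radius (fps_deriv w)" by (rule fps_conv_radius_deriv)
    also have "\<dots> = min (fps_conv_radius (fps_X :: real fps)) (fps_conv_radius (fps_deriv w))" by simp
    also have "\<dots> \<le> fps_conv_radius (fps_X * fps_deriv w)" by (rule fps_conv_radius_mult)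
    finally have "summable (\<lambda>n. fps_nth (fps_X * fps_deriv w) n * t ^ n)"
      using t by (intro summable_fps) simp
    moreover have nth: "fps_nth (fps_X * fps_deriv w) n = real n * fps_nth w n" for n
      by (cases n) auto
    ultimately have sm: "summable (\<lambda>n. real n * fps_nth w n * t ^ n)" by simp
    have "real K \<le> (\<Sum>n. real n * fps_nth w n * t ^ n)" for K
    proof -
      have sums: "(\<lambda>n. fps_nth ((fps_X * S) ^ m) n * t ^ n) sums 1" for m
      proof -
        have "summable (\<lambda>n. fps_nth (fps_X ^ m * S ^ m) n * t ^ n)"
          using rad[of t m m] t by (intro summable_fps) simp
        moreover have "eval_fps (fps_X ^ m * S ^ m) t = 1"
          using ev[of t m m] t by (simp flip: power_mult_distrib)
        ultimately show ?thesis by (simp add: power_mult_distrib eval_fps_def sums_iff)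
      qed
      have "(\<lambda>n. \<Sum>m=1..K. fps_nth ((fps_X * S) ^ m) n * t ^ n) sums (\<Sum>m=1..K. 1)"
        by (intro sums_sum sums)
      then have K: "(\<lambda>n. \<Sum>m=1..K. fps_nth ((fps_X * S) ^ m) n * t ^ n) sums real K" by simp
      have "(\<Sum>m=1..K. fps_nth ((fps_X * S) ^ m) n * t ^ n) \<le> real n * fps_nth w n * t ^ n" for n
      proof -
        have z: "fps_nth ((fps_X * S) ^ m) n = 0" if "n < m" for m
          using that by (simp add: power_mult_distrib fps_X_power_mult_nth_less)
        have pos: "0 \<le> fps_nth ((fps_X * S) ^ m) n" for m using nnX by (simp add: power_mult_distrib)
        have "(\<Sum>m=1..K. fps_nth ((fps_X * S) ^ m) n) \<le> (\<Sum>m=1..max K n. fps_nth ((fps_X * S) ^ m) n)"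
          using pos by (intro sum_mono2) auto
        also have "\<dots> = (\<Sum>m=1..n. fps_nth ((fps_X * S) ^ m) n)"
          by (rule sum.mono_neutral_right) (auto intro: z)
        also have "\<dots> \<le> real n * N n" by (rule N_ge)
        also have "\<dots> \<le> real n * fps_nth w n" using w[of n] N0[of n] M0[of n] by (intro mult_left_mono) auto
        finally have "(\<Sum>m=1..K. fps_nth ((fps_X * S) ^ m) n) * t ^ n \<le> real n * fps_nth w n * t ^ n"
          using t by (intro mult_right_mono) auto
        then show ?thesis by (simp add: sum_distrib_right)
      qed
      then show ?thesis using K sm by (metis (no_types, lifting) suminf_le sums_iff)
    qed
    then show False using reals_Archimedean2 by (meson not_less)
  qed
  ultimately show ?thesis by (simp add: antisym not_less)
qed

section \<open>The conjugacy growth series of the wreath product\<close>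

context word_group
begin

lemma growth_series_eq: "growth_series H Z = weight_series (carrier H) len"
  by (simp add: growth_series_def weight_series_def)

lemma conj_growth_series_W_nth:
  "fps_nth (conj_growth_series W V) n =
     2 * (\<Sum>m=1..n. real (card (necklaces (carrier H) len m (n - m)))) + real (card (classes_at 0 n))"
  unfolding conj_growth_series_def by (simp add: card_classes_W)

lemma conj_growth_series_W:
  "conj_growth_series W V = 2 * (\<Sum>\<^sub>\<infinity>r\<in>{1..}. necklace_sum (growth_series H Z) r)
     + conj_growth_series H Z + fps_X\<^sup>2 * (conj_growth_series H Z - 1)\<^sup>2
         / (1 - fps_X\<^sup>2 * conj_growth_series H Z)"
proof (rule fps_ext)
  fix n
  show "fps_nth (conj_growth_series W V) n = fps_nth (2 * (\<Sum>\<^sub>\<infinity>r\<in>{1..}. necklace_sum (growth_series H Z) r)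
     + conj_growth_series H Z + fps_X\<^sup>2 * (conj_growth_series H Z - 1)\<^sup>2
         / (1 - fps_X\<^sup>2 * conj_growth_series H Z)) n"
    unfolding conj_growth_series_W_nth sphere.necklace_sum_eq_card card_classes_still_series growth_series_eq
    by (simp add: numeral_fps_const)
qed

lemma growth_series_0: "fps_nth (growth_series H Z) 0 = 1"
proof -
  have "{h \<in> carrier H. len h = 0} = {\<one>}" using len_eq_0_iff by auto
  then show ?thesis by (simp add: growth_series_def)
qed

lemma growth_series_nonneg: "0 \<le> fps_nth (growth_series H Z) n"
  by (simp add: growth_series_def)

lemma growth_series_submult:
  "fps_nth (growth_series H Z) (m + n) \<le> fps_nth (growth_series H Z) m * fps_nth (growth_series H Z) n"
  using sphere_card_submult[of m n] by (simp add: growth_series_def flip: of_nat_mult)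

text \<open>Coefficientwise, the conjugacy growth series is at most the standard one: each class contains an
  element of its own length.\<close>

lemma card_classes_still_le:
  "real (card (classes_at 0 n)) \<le> fps_nth (1 + (\<Sum>k\<le>Suc n. fps_X ^ (2 * k) * growth_series H Z ^ Suc k)) n"
proof -
  let ?c = "conj_growth_series H Z" and ?S = "growth_series H Z"
  have c: "0 \<le> fps_nth ?c n" "fps_nth ?c n \<le> fps_nth ?S n" for n
    using card_classes_le[of n] by (auto simp: conj_growth_series_def growth_series_def)
  have d: "0 \<le> fps_nth (?c - 1) n" for n
    by (simp add: nontrivial_classes_series[symmetric] weight_series_def)
  have dS: "fps_nth (?c - 1) n \<le> fps_nth ?S n" for n using c(2)[of n] by (cases n) auto
  have X: "0 \<le> fps_nth (fps_X ^ k :: real fps) n" for k n by (simp add: fps_X_power_nth)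
  have le: "fps_nth (fps_X ^ (2 * k) * (if k = 0 then ?c - 1 else (?c - 1)\<^sup>2 * ?c ^ (k - 1))) n
      \<le> fps_nth (fps_X ^ (2 * k) * ?S ^ Suc k) n" for k
  proof (cases k)
    case 0
    then show ?thesis using dS[of n] by simp
  next
    case (Suc j)
    have p: "0 \<le> fps_nth ((?c - 1)\<^sup>2) n" "fps_nth ((?c - 1)\<^sup>2) n \<le> fps_nth (?S\<^sup>2) n" for n
      using fps_power_nth_mono[of "?c - 1" ?S 2 n] d dS by auto
    have q: "0 \<le> fps_nth (?c ^ j) n" "fps_nth (?c ^ j) n \<le> fps_nth (?S ^ j) n" for n
      using fps_power_nth_mono[of ?c ?S j n] c by auto
    note pq = fps_mult_nth_mono[of "(?c - 1)\<^sup>2" "?S\<^sup>2" "?c ^ j" "?S ^ j", OF p q]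
    have "fps_nth (fps_X ^ (2 * k) * ((?c - 1)\<^sup>2 * ?c ^ j)) n \<le> fps_nth (fps_X ^ (2 * k) * (?S\<^sup>2 * ?S ^ j)) n"
      by (rule fps_mult_nth_mono(2)[OF X order_refl pq])
    moreover have "?S\<^sup>2 * ?S ^ j = ?S ^ Suc k" by (simp add: Suc power2_eq_square mult.assoc)
    moreover have "(if k = 0 then ?c - 1 else (?c - 1)\<^sup>2 * ?c ^ (k - 1)) = (?c - 1)\<^sup>2 * ?c ^ j"
      by (simp add: Suc)
    ultimately show ?thesis by (simp only:)
  qed
  show ?thesis
    unfolding card_classes_still fps_add_nth fps_sum_nth by (intro add_left_mono sum_mono le)
qed

lemma conv_radius_conj_growth_series_W:
  assumes "t > 0" "ereal t < fps_conv_radius (growth_series H Z)" "t * eval_fps (growth_series H Z) t = 1"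
  shows "fps_conv_radius (conj_growth_series W V) = ereal t"
proof (rule conv_radius_necklace_growth[OF growth_series_0 _ assms conj_growth_series_W_nth])
  let ?N = "\<lambda>m n. real (card (necklaces (carrier H) len m (n - m)))"
  have nth: "fps_nth ((fps_X * growth_series H Z) ^ m) n = fps_nth (growth_series H Z ^ m) (n - m)"
    if "m \<in> {1..n}" for m n
    using that by (simp add: power_mult_distrib fps_X_power_mult_nth)
  show "(\<Sum>m=1..n. ?N m n) \<le> (\<Sum>m=1..n. fps_nth ((fps_X * growth_series H Z) ^ m) n)" for n
  proof (rule sum_mono)
    fix m assume m: "m \<in> {1..n}"
    then show "?N m n \<le> fps_nth ((fps_X * growth_series H Z) ^ m) n"
      unfolding nth[OF m] unfolding growth_series_eq by (intro sphere.necklaces_bounds(1)) simp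
  qed
  show "(\<Sum>m=1..n. fps_nth ((fps_X * growth_series H Z) ^ m) n) \<le> real n * (\<Sum>m=1..n. ?N m n)" for n
    unfolding sum_distrib_left
  proof (rule sum_mono)
    fix m assume m: "m \<in> {1..n}"
    then have "fps_nth ((fps_X * growth_series H Z) ^ m) n \<le> real m * ?N m n"
      unfolding nth[OF m] unfolding growth_series_eq by (intro sphere.necklaces_bounds(2)) simp
    also have "\<dots> \<le> real n * ?N m n" using m by (intro mult_right_mono) auto
    finally show "fps_nth ((fps_X * growth_series H Z) ^ m) n \<le> real n * ?N m n" .
  qed
  show "0 \<le> fps_nth (growth_series H Z) n" for n by (rule growth_series_nonneg)
  show "real (card (classes_at 0 n)) \<le>
      fps_nth (1 + (\<Sum>k\<le>Suc n. fps_X ^ (2 * k) * growth_series H Z ^ Suc k)) n" for n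
    by (rule card_classes_still_le)
qed (auto intro: sum_nonneg)

end

theorem mainTheorem7:
  fixes G :: "('a, 'b) monoid_scheme" and Y :: "'a set"
  assumes "group G" and "fin_sym_gen_set G Y"
  shows
    "let \<sigma> = growth_series G Y;
         \<sigma>c = conj_growth_series G Y;
         \<sigma>w = conj_growth_series (wreath_product G integer_group)
                (wreath_gens G Y integer_group {1, -1});
         f = (\<lambda>r s. fps_const (1 / real s) * (fps_X ^ (r * s) * (\<sigma> oo fps_X ^ r) ^ s));
         g = (\<lambda>r. fps_const (real (totient r) / real r) * (\<Sum>\<^sub>\<infinity>s\<in>{1..}. f r s))
     in (\<forall>r\<ge>1. f r summable_on {1..})
        \<and> g summable_on {1..}
        \<and> \<sigma>w = 2 * (\<Sum>\<^sub>\<infinity>r\<in>{1..}. g r)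
               + \<sigma>c + fps_X\<^sup>2 * (\<sigma>c - 1)\<^sup>2 / (1 - fps_X\<^sup>2 * \<sigma>c)
        \<and> (\<exists>t. (\<forall>u. (u > 0 \<and> summable (\<lambda>n. fps_nth \<sigma> n * u ^ n) \<and> u * eval_fps \<sigma> u = 1)
                     \<longleftrightarrow> u = t)
               \<and> fps_conv_radius \<sigma>w = ereal t)"
proof -
  interpret word_group G Y by (rule group.word_groupI[OF assms])
  have f: "(\<lambda>s. fps_const (1 / real s) * (fps_X ^ (r * s) * (growth_series G Y oo fps_X ^ r) ^ s))
      = necklace_term (growth_series G Y) r" for r
    by (intro ext) (simp add: necklace_term_def)
  have g: "(\<lambda>r. fps_const (real (totient r) / real r) * infsum (necklace_term (growth_series G Y) r) {1..})
      = necklace_sum (growth_series G Y)"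
    by (intro ext) (simp add: necklace_sum_def)
  obtain t where t: "t > 0" "ereal t < fps_conv_radius (growth_series G Y)" "t * eval_fps (growth_series G Y) t = 1"
    "\<forall>u. (u > 0 \<and> summable (\<lambda>n. fps_nth (growth_series G Y) n * u ^ n) \<and>
      u * eval_fps (growth_series G Y) u = 1) \<longleftrightarrow> u = t"
    using unique_solution[OF growth_series_0 growth_series_nonneg growth_series_submult] .
  show ?thesis
    unfolding Let_def f g
  proof (intro conjI allI impI)
    show "necklace_term (growth_series G Y) r summable_on {1..}" if "r \<ge> 1" for r
      by (rule has_sum_imp_summable[OF necklace_term_has_sum[OF that]])
    show "necklace_sum (growth_series G Y) summable_on {1..}"
      by (rule has_sum_imp_summable[OF necklace_sum_has_sum])
    show "\<exists>t. (\<forall>u. (u > 0 \<and> summable (\<lambda>n. fps_nth (growth_series G Y) n * u ^ n) \<and>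
        u * eval_fps (growth_series G Y) u = 1) \<longleftrightarrow> u = t) \<and> fps_conv_radius (conj_growth_series W V) = ereal t"
      using t(4) conv_radius_conj_growth_series_W[OF t(1-3)] by blast
  qed (rule conj_growth_series_W)
qed

end
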